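(* Let $(X,d^X)$ be a graph with bounded geometry which is roughly isometric to a Cayley graph $(G,S,d^S)$ of a group $G$ of polynomial volume growth with homogeneous dimension $D$. Then there is a constant $C$ (independent of $d$) such that for every $d\geq1$, $$\dim H^d(X)\leq C\,d^{D-1}.$$
   Context: Graphs are connected, locally finite, without self-loops or multiple edges; $d^X$ is the graph (path-length) metric. $X$ has bounded geometry if $\deg x\leq\Delta$ for all vertices $x$ and some $\Delta>0$. For a group $G$ with finite symmetric generating set $S$, the Cayley graph has $x\sim y$ iff $x=ys$ for some $s\in S$, with word metric $d^S$. $G$ has polynomial volume growth if $|\{x: d^S(e,x)\le n\}|\leq Cn^A$ for some $C,A>0$ and all $n\ge1$; then there are an integer $D$ (homogeneous dimension) and $C_1,C_2>0$ with $C_1n^D\leq |\{x: d^S(e,x)\le n\}|\leq C_2n^D$ for all $n\geq1$. A map $\phi:X\to Y$ between metric spaces is an $(a,b)$-rough isometry ($a\geq1,b\geq0$) if $a^{-1}d^X(x,y)-b\leq d^Y(\phi(x),\phi(y))\leq a\,d^X(x,y)+b$ for all $x,y$ and every $z\in Y$ has distance at most $b$ from $\phi(X)$; $X$ and $Y$ are roughly isometric if such a map exists. The Laplacian on $X$ is $L^Xu(x)=\sum_{y\sim x}(u(y)-u(x))$. For fixed $p\in X$, $H^d(X)=\{u:X\to\mathbb{R}\mid L^Xu=0,\ |u(x)|\leq C(d^X(x,p)+1)^d\text{ for some }C\}$.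
   Formalization: For D = 0 (finite G) the exponent D−1 is read as 0 instead of −1, since constants give dim H^d(X) ≥ 1 for every d and the bound C/d would fail; for D ≥ 1 the statement is unchanged. *)

theory Defs
  imports "HOL-Analysis.Analysis" "HOL-Library.Function_Algebras"
begin

definition walk :: "('a \<Rightarrow> 'a \<Rightarrow> bool) \<Rightarrow> nat \<Rightarrow> 'a \<Rightarrow> 'a \<Rightarrow> bool" where
  "walk E n x y \<longleftrightarrow> (\<exists>f :: nat \<Rightarrow> 'a. f 0 = x \<and> f n = y \<and> (\<forall>i<n. E (f i) (f (Suc i))))"

definition graph :: "('a \<Rightarrow> 'a \<Rightarrow> bool) \<Rightarrow> bool" where
  "graph E \<longleftrightarrow> (\<forall>x y. E x y \<longrightarrow> E y x) \<and> (\<forall>x. \<not> E x x)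
     \<and> (\<forall>x. finite {y. E x y}) \<and> (\<forall>x y. \<exists>n. walk E n x y)"

definition gdist :: "('a \<Rightarrow> 'a \<Rightarrow> bool) \<Rightarrow> 'a \<Rightarrow> 'a \<Rightarrow> nat" where
  "gdist E x y = (LEAST n. walk E n x y)"

definition bounded_geometry :: "('a \<Rightarrow> 'a \<Rightarrow> bool) \<Rightarrow> bool" where
  "bounded_geometry E \<longleftrightarrow> (\<exists>\<Delta>::nat. \<forall>x. card {y. E x y} \<le> \<Delta>)"

text \<open>Groups are written additively (type class group_add, not necessarily commutative).
  Subgroup generated by S.\<close>
inductive_set generated :: "'g::group_add set \<Rightarrow> 'g set" for S where
  gen_zero: "0 \<in> generated S"
| gen_step: "x \<in> generated S \<Longrightarrow> s \<in> S \<Longrightarrow> x + s \<in> generated S"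

definition finite_symmetric_generating :: "'g::group_add set \<Rightarrow> bool" where
  "finite_symmetric_generating S \<longleftrightarrow> finite S \<and> (\<forall>s\<in>S. - s \<in> S) \<and> generated S = UNIV"

definition cayley :: "'g::group_add set \<Rightarrow> 'g \<Rightarrow> 'g \<Rightarrow> bool" where
  "cayley S x y \<longleftrightarrow> (\<exists>s\<in>S. x = y + s)"

definition word_dist :: "'g::group_add set \<Rightarrow> 'g \<Rightarrow> 'g \<Rightarrow> nat" where
  "word_dist S = gdist (cayley S)"

definition word_ball :: "'g::group_add set \<Rightarrow> nat \<Rightarrow> 'g set" where
  "word_ball S n = {x. word_dist S 0 x \<le> n}"

definition polynomial_growth :: "'g::group_add set \<Rightarrow> bool" where
  "polynomial_growth S \<longleftrightarrow> (\<exists>C A::real. C > 0 \<and> A > 0 \<and>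
     (\<forall>n::nat. n \<ge> 1 \<longrightarrow> real (card (word_ball S n)) \<le> C * real n powr A))"

definition homogeneous_dimension :: "'g::group_add set \<Rightarrow> nat \<Rightarrow> bool" where
  "homogeneous_dimension S D \<longleftrightarrow> (\<exists>C1 C2::real. C1 > 0 \<and> C2 > 0 \<and>
     (\<forall>n::nat. n \<ge> 1 \<longrightarrow> C1 * real n ^ D \<le> real (card (word_ball S n))
                      \<and> real (card (word_ball S n)) \<le> C2 * real n ^ D))"

definition rough_isometry ::
  "('a \<Rightarrow> 'a \<Rightarrow> real) \<Rightarrow> ('b \<Rightarrow> 'b \<Rightarrow> real) \<Rightarrow> real \<Rightarrow> real \<Rightarrow> ('a \<Rightarrow> 'b) \<Rightarrow> bool" where
  "rough_isometry dX dY a b \<phi> \<longleftrightarrow> a \<ge> 1 \<and> b \<ge> 0 \<and>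
     (\<forall>x y. dX x y / a - b \<le> dY (\<phi> x) (\<phi> y) \<and> dY (\<phi> x) (\<phi> y) \<le> a * dX x y + b) \<and>
     (\<forall>z. \<exists>x. dY z (\<phi> x) \<le> b)"

definition roughly_isometric :: "('a \<Rightarrow> 'a \<Rightarrow> real) \<Rightarrow> ('b \<Rightarrow> 'b \<Rightarrow> real) \<Rightarrow> bool" where
  "roughly_isometric dX dY \<longleftrightarrow> (\<exists>a b \<phi>. rough_isometry dX dY a b \<phi>)"

definition laplacian :: "('a \<Rightarrow> 'a \<Rightarrow> bool) \<Rightarrow> ('a \<Rightarrow> real) \<Rightarrow> 'a \<Rightarrow> real" where
  "laplacian E u x = (\<Sum>y\<in>{y. E x y}. u y - u x)"

definition Hd :: "('a \<Rightarrow> 'a \<Rightarrow> bool) \<Rightarrow> 'a \<Rightarrow> real \<Rightarrow> ('a \<Rightarrow> real) set" where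
  "Hd E p d = {u. (\<forall>x. laplacian E u x = 0) \<and>
      (\<exists>C. \<forall>x. \<bar>u x\<bar> \<le> C * (real (gdist E x p) + 1) powr d)}"

definition fscale :: "real \<Rightarrow> ('a \<Rightarrow> real) \<Rightarrow> ('a \<Rightarrow> real)" where
  "fscale c f = (\<lambda>x. c * f x)"

definition fin_dim_fun :: "('a \<Rightarrow> real) set \<Rightarrow> bool" where
  "fin_dim_fun H \<longleftrightarrow> (\<exists>B. finite B \<and> B \<subseteq> H \<and> module.span fscale B = H)"

end

(* Pull the word length back along the rough isometry phi : X -> G and write |x| for the length of
   phi x and B_R for {|x| <= R}.  Let V be a K-dimensional space of harmonic functions of growth d
   and put n = ceiling d.

   Cover B_R by the sets Q_g = {x : phi x lies in the ball of radius 3 eta t(g) about g}, where t is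
   the distance to the sphere of radius R + T.  The Poincare inequality on each Q_g and a single
   Caccioppoli inequality with cutoff function t give, for harmonic u,
     sum_{B_R} u^2 <= C eta^2 sum_{B_{R+T}} u^2 + sum_g |Q_g| (mean of u over Q_g)^2,
   with at most C_eta sum_h t(h)^(-D) sets Q_g.  Summing over a Gram-Schmidt basis of V with respect
   to B_{R+T}, Bessel's inequality bounds the last term by the number of sets Q_g.

   Among the n steps R = (n + i) T, i < n, the volumes sum_h t(h)^(-D) have average O(n^(D-1)) (here
   D >= 2 is used), and for suitable T the logarithm of the Gram determinant of V grows by O(K) on
   average.  A step that is good for both gives K e^(-s) <= K e^(-s) / 2 + O(n^(D-1)), the constant s
   being independent of eta and d.  For D <= 1 the maximum principle suffices. *)

theory Submission
  imports Defs
begin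

subsection \<open>Walks and word length\<close>

text \<open>The exponent D - 1 is the difficulty. Covering the ball of radius n T by balls of one
  size eta T takes about n^D of them. Caccioppoli with the cutoff t is stronger far inside the ball,
  so the sets may grow in proportion to t and only those near the outer sphere are numerous, ideally
  about n^(D-1). Counting them for a single sphere would need a volume bound for thin shells, which
  two-sided bounds for balls do not give. Averaging replaces it: when the sphere moves through n
  radii with spacing T, each group element h sees values t(h) in arithmetic progression, the sum of
  t^(-D) over them is O(T^(-D)), and multiplying by the O((n T)^D) elements h gives n^D for n steps
  together. Steps of relative width 1/n with n about d are just short enough that growth of order d
  costs a constant factor per step. This factor is known before the covering is chosen, so eta may
  depend on it; T may depend even on V, since it does not enter the final bound.\<close>

lemma walk_0: "walk E 0 x x"
  unfolding walk_def by (intro exI[of _ "\<lambda>_. x"]) auto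

lemma walk_Suc:
  assumes "walk E n x y" "E y z"
  shows "walk E (Suc n) x z"
proof -
  obtain f where f: "f 0 = x" "f n = y" "\<forall>i<n. E (f i) (f (Suc i))"
    using assms(1) unfolding walk_def by auto
  show ?thesis unfolding walk_def
    by (intro exI[of _ "f(Suc n := z)"]) (use f assms(2) in \<open>auto simp: less_Suc_eq\<close>)
qed

lemma walk_SucD:
  assumes "walk E (Suc n) x z"
  obtains y where "walk E n x y" "E y z"
proof -
  obtain f where f: "f 0 = x" "f (Suc n) = z" "\<forall>i<Suc n. E (f i) (f (Suc i))"
    using assms unfolding walk_def by auto
  have "walk E n x (f n)" unfolding walk_def using f by auto
  moreover have "E (f n) z" using f by auto
  ultimately show ?thesis using that by blast
qed

lemma walk_trans:
  assumes "walk E m x y" "walk E n y z"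
  shows "walk E (m + n) x z"
  using assms(2)
proof (induction n arbitrary: z)
  case 0
  then show ?case using assms(1) by (auto simp: walk_def)
next
  case (Suc n)
  from Suc.prems obtain w where "walk E n y w" "E w z" by (rule walk_SucD)
  then show ?case using Suc.IH walk_Suc by fastforce
qed

lemma walk_le:
  assumes "walk E n x y"
  shows "gdist E x y \<le> n"
  unfolding gdist_def using assms by (rule Least_le)

lemma walk_gdist:
  assumes "\<exists>n. walk E n x y"
  shows "walk E (gdist E x y) x y"
  unfolding gdist_def using assms by (rule LeastI_ex)

section \<open>The word metric: left invariance, geodesics and balls\<close>

locale word_group =
  fixes S :: "'g::group_add set"
  assumes gen: "finite_symmetric_generating S"
begin

definition len :: "'g \<Rightarrow> nat" where "len g = word_dist S 0 g"

lemma S_minus: "s \<in> S \<Longrightarrow> - s \<in> S"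
  using gen by (auto simp: finite_symmetric_generating_def)

text \<open>Symmetry of \<open>S\<close> turns the definition into a condition on the left quotient
  \<open>- x + y\<close> alone, which left translations do not change. All distances in the group
  are expressed through this quotient.\<close>

lemma cayley_iff: "cayley S x y \<longleftrightarrow> - x + y \<in> S"
proof
  assume "cayley S x y"
  then obtain s where s: "s \<in> S" "x = y + s" by (auto simp: cayley_def)
  then have "- x + y = - s" by (simp add: minus_add)
  then show "- x + y \<in> S" using s S_minus by simp
next
  assume "- x + y \<in> S"
  then have "- (- x + y) \<in> S" by (rule S_minus)
  moreover have "x = y + - (- x + y)" by (simp add: minus_add flip: add.assoc)
  ultimately show "cayley S x y" unfolding cayley_def by (rule bexI[rotated])
qed

lemma left_translate [simp]: "- (g + a) + (g + b) = - a + b" for a b g :: 'g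
  by (simp only: minus_add add.assoc minus_add_cancel)

lemma walk_translate:
  assumes "walk (cayley S) n x y"
  shows "walk (cayley S) n (g + x) (g + y)"
proof -
  obtain f where "f 0 = x" "f n = y" "\<forall>i<n. cayley S (f i) (f (Suc i))"
    using assms unfolding walk_def by auto
  then show ?thesis unfolding walk_def
    by (intro exI[of _ "\<lambda>i. g + f i"])
       (auto simp: cayley_iff)
qed

lemma ex_walk_zero: "\<exists>n. walk (cayley S) n 0 g"
proof -
  have "g \<in> generated S" using gen by (simp add: finite_symmetric_generating_def)
  then show ?thesis
  proof induction
    case gen_zero
    show ?case by (rule exI, rule walk_0)
  next
    case (gen_step x s)
    then obtain n where "walk (cayley S) n 0 x" by blast
    moreover have "cayley S x (x + s)" using gen_step by (simp add: cayley_iff flip: add.assoc)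
    ultimately have "walk (cayley S) (Suc n) 0 (x + s)" by (rule walk_Suc)
    then show ?case by (rule exI)
  qed
qed

lemma walk_len: "walk (cayley S) (len g) 0 g"
  unfolding len_def word_dist_def by (rule walk_gdist[OF ex_walk_zero])

lemma len_le: "walk (cayley S) n 0 g \<Longrightarrow> len g \<le> n"
  unfolding len_def word_dist_def by (rule walk_le)

lemma word_dist_len: "word_dist S x y = len (- x + y)"
proof -
  have "walk (cayley S) n x y \<longleftrightarrow> walk (cayley S) n 0 (- x + y)" for n
    using walk_translate[of n x y "- x"] walk_translate[of n 0 "- x + y" x]
    by (auto simp flip: add.assoc)
  then show ?thesis by (simp add: len_def word_dist_def gdist_def)
qed

lemma len_zero [simp]: "len 0 = 0"
  using len_le[OF walk_0] by simp

lemma len_add: "len (g + h) \<le> len g + len h"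
  using walk_trans[OF walk_len[of g] walk_translate[OF walk_len[of h], of g, simplified]] by (rule len_le)

lemma walk_mirror:
  assumes "walk (cayley S) n x y"
  shows "walk (cayley S) n y x"
proof -
  obtain f where f: "f 0 = x" "f n = y" "\<forall>i<n. cayley S (f i) (f (Suc i))"
    using assms unfolding walk_def by auto
  have sym: "cayley S a b \<Longrightarrow> cayley S b a" for a b
    using S_minus[of "- a + b"] by (simp add: cayley_iff minus_add)
  have "cayley S (f (n - i)) (f (n - Suc i))" if "i < n" for i
  proof -
    have "n - i = Suc (n - Suc i)" "n - Suc i < n" using that by auto
    then show ?thesis using f(3) sym by metis
  qed
  then show ?thesis unfolding walk_def
    by (intro exI[of _ "\<lambda>i. f (n - i)"]) (use f in auto)
qed

lemma len_uminus [simp]: "len (- g) = len g"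
proof -
  have "len (- h) \<le> len h" for h
    using walk_translate[OF walk_mirror[OF walk_len[of h]], of "- h"] by (auto intro: len_le)
  from this[of g] this[of "- g"] show ?thesis by simp
qed

lemma len_triangle: "len (- x + z) \<le> len (- x + y) + len (- y + z)"
  using len_add[of "- x + y" "- y + z"] by (simp add: add.assoc)

lemma len_commute: "len (- x + y) = len (- y + x)"
  using len_uminus[of "- x + y"] by (simp add: minus_add)

lemma len_lipschitz: "\<bar>real (len x) - real (len y)\<bar> \<le> real (len (- x + y))"
proof -
  have "len y \<le> len x + len (- x + y)" using len_triangle[of 0 y x] by simp
  moreover have "len x \<le> len y + len (- x + y)" using len_triangle[of 0 x y] len_commute[of x y] by simp
  ultimately show ?thesis by linarith
qed

lemma finite_len_le: "finite {g. len g \<le> n}"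
proof (induction n)
  case 0
  have "{g. len g \<le> 0} \<subseteq> {0}"
  proof
    fix g assume "g \<in> {g. len g \<le> 0}"
    then show "g \<in> {0}" using walk_len[of g] by (auto simp: walk_def)
  qed
  then show ?case by (rule finite_subset) simp
next
  case (Suc n)
  have "finite S" using gen by (simp add: finite_symmetric_generating_def)
  have "{g. len g \<le> Suc n} \<subseteq> {g. len g \<le> n} \<union> (\<lambda>(y, s). y + s) ` ({g. len g \<le> n} \<times> S)"
  proof
    fix g assume g: "g \<in> {g. len g \<le> Suc n}"
    show "g \<in> {g. len g \<le> n} \<union> (\<lambda>(y, s). y + s) ` ({g. len g \<le> n} \<times> S)"
    proof (cases "len g \<le> n")
      case False
      then have "len g = Suc n" using g by simp
      with walk_len[of g] obtain y where y: "walk (cayley S) n 0 y" "cayley S y g"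
        by (metis walk_SucD)
      have "g = y + (- y + g)" by (simp flip: add.assoc)
      then show ?thesis using y len_le[of n y] by (force simp: cayley_iff)
    qed simp
  qed
  then show ?case by (rule finite_subset) (use Suc \<open>finite S\<close> in auto)
qed

text \<open>The path stays at \<open>h\<close> once it has arrived, so that geodesics of different
  lengths can be summed over one common range of times. Because of these resting steps an increment
  has length at most 1 instead of being an edge.\<close>

lemma ex_geodesic:
  "\<exists>\<gamma>. \<gamma> 0 = 0 \<and> (\<forall>k\<ge>len h. \<gamma> k = h) \<and> (\<forall>k. len (- \<gamma> k + \<gamma> (Suc k)) \<le> 1) \<and> (\<forall>k. len (\<gamma> k) \<le> len h)"
proof -
  obtain f where f: "f 0 = 0" "f (len h) = h" "\<forall>i<len h. cayley S (f i) (f (Suc i))"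
    using walk_len[of h] unfolding walk_def by auto
  define \<gamma> where "\<gamma> k = f (min k (len h))" for k
  have "len s \<le> 1" if "s \<in> S" for s
    using walk_Suc[OF walk_0, of "cayley S" 0 s] that by (auto simp: cayley_iff intro: len_le)
  then have "len (- f i + f (Suc i)) \<le> 1" if "i < len h" for i
    using f(3) that by (simp add: cayley_iff)
  then have "len (- \<gamma> k + \<gamma> (Suc k)) \<le> 1" for k
    unfolding \<gamma>_def by (cases "k < len h") (auto simp: min_def le_Suc_eq)
  moreover have "len (\<gamma> k) \<le> len h" for k
  proof -
    have "walk (cayley S) (min k (len h)) 0 (\<gamma> k)"
      unfolding walk_def \<gamma>_def by (rule exI[of _ f]) (use f in auto)
    then show ?thesis using len_le by fastforce
  qed
  ultimately show ?thesis using f by (intro exI[of _ \<gamma>]) (auto simp: \<gamma>_def)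
qed

text \<open>One geodesic is fixed for each group element. For a fixed increment \<open>h\<close> and
  time \<open>k\<close>, moving \<open>g\<close> along its geodesic is then the right translation by
  \<open>geod h k\<close>, which is injective; the Poincare inequality rests on this.\<close>

definition geod :: "'g \<Rightarrow> nat \<Rightarrow> 'g" where
  "geod h = (SOME \<gamma>. \<gamma> 0 = 0 \<and> (\<forall>k\<ge>len h. \<gamma> k = h) \<and>
     (\<forall>k. len (- \<gamma> k + \<gamma> (Suc k)) \<le> 1) \<and> (\<forall>k. len (\<gamma> k) \<le> len h))"

lemma geod:
  "geod h 0 = 0" "len h \<le> k \<Longrightarrow> geod h k = h"
  "len (- geod h k + geod h (Suc k)) \<le> 1" "len (geod h k) \<le> len h"
  using someI_ex[OF ex_geodesic[of h], folded geod_def] by auto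

definition gball :: "'g \<Rightarrow> real \<Rightarrow> 'g set" where
  "gball g r = {h. real (len (- g + h)) \<le> r}"

lemma gball_translate: "gball g r = (+) g ` gball 0 r"
proof (intro set_eqI iffI)
  fix h assume "h \<in> gball g r"
  then show "h \<in> (+) g ` gball 0 r"
    by (intro image_eqI[of _ _ "- g + h"]) (auto simp: gball_def simp flip: add.assoc)
qed (auto simp: gball_def simp flip: add.assoc)

lemma finite_gball [simp]: "finite (gball g r)"
proof -
  have "gball 0 r \<subseteq> {h. len h \<le> nat \<lfloor>r\<rfloor>}" by (auto simp: gball_def le_nat_floor)
  then have "finite (gball 0 r)" using finite_len_le finite_subset by blast
  then show ?thesis by (subst gball_translate) simp
qed

lemma card_gball: "card (gball g r) = card (gball 0 r)"
  by (subst gball_translate) (simp add: card_image)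

lemma gball_center [simp]: "0 \<le> r \<Longrightarrow> g \<in> gball g r"
  by (simp add: gball_def)

end

locale growth_group = word_group S for S :: "'g::group_add set" +
  fixes D :: nat and c\<^sub>1 c\<^sub>2 :: real
  assumes c\<^sub>1: "c\<^sub>1 > 0" and c\<^sub>2: "c\<^sub>2 > 0"
    and gball_lower: "\<And>r g. r \<ge> 1 \<Longrightarrow> c\<^sub>1 * r ^ D \<le> card (gball g r)"
    and gball_upper: "\<And>r g. r \<ge> 1 \<Longrightarrow> card (gball g r) \<le> c\<^sub>2 * r ^ D"

lemma ex_growth_group:
  assumes "finite_symmetric_generating S" "homogeneous_dimension S D"
  shows "\<exists>c\<^sub>1 c\<^sub>2. growth_group S D c\<^sub>1 c\<^sub>2"
proof -
  interpret word_group S using assms(1) by unfold_locales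
  obtain C1 C2 where C: "C1 > 0" "C2 > 0"
    "\<And>n. n \<ge> 1 \<Longrightarrow> C1 * real n ^ D \<le> card (word_ball S n) \<and> card (word_ball S n) \<le> C2 * real n ^ D"
    using assms(2) unfolding homogeneous_dimension_def by auto
  have wb: "gball 0 r = word_ball S (nat \<lfloor>r\<rfloor>)" if "r \<ge> 1" for r
    using that by (auto simp: gball_def word_ball_def len_def le_nat_floor le_nat_iff le_floor_iff)
  show ?thesis
  proof (intro exI growth_group.intro growth_group_axioms.intro)
    show "word_group S" by unfold_locales
    \<comment> \<open>The passage to real radii uses n = floor r; since r \<le> 2 n, the lower
      constant loses the factor 2^D.\<close>
    show "C1 / 2 ^ D > 0" "C2 > 0" using C by auto
    fix r :: real and g :: 'a assume r: "r \<ge> 1"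
    define n where "n = nat \<lfloor>r\<rfloor>"
    have n: "n \<ge> 1" using r unfolding n_def by linarith
    have "real n \<le> r" "r < real n + 1" using r unfolding n_def by linarith+
    with n have n: "n \<ge> 1" "real n \<le> r" "r \<le> 2 * real n" by auto
    have "C1 / 2 ^ D * r ^ D \<le> C1 / 2 ^ D * (2 * real n) ^ D"
      using C n r by (intro mult_left_mono power_mono) auto
    also have "\<dots> = C1 * real n ^ D" by (simp add: power_mult_distrib)
    also have "\<dots> \<le> card (gball g r)" using C(3)[OF n(1)] wb[OF r] by (simp add: card_gball[of g] n_def)
    finally show "C1 / 2 ^ D * r ^ D \<le> card (gball g r)" .
    have "card (gball g r) \<le> C2 * real n ^ D" using C(3)[OF n(1)] wb[OF r] by (simp add: card_gball[of g] n_def)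
    also have "\<dots> \<le> C2 * r ^ D" using C n by (intro mult_left_mono power_mono) auto
    finally show "card (gball g r) \<le> C2 * r ^ D" .
  qed
qed

subsection \<open>A Poincare inequality on pulled-back balls\<close>

lemma power2_sum_le:
  fixes a :: "nat \<Rightarrow> real"
  shows "(\<Sum>k<n. a k)\<^sup>2 \<le> n * (\<Sum>k<n. (a k)\<^sup>2)"
  using Cauchy_Schwarz_ineq_sum[of "\<lambda>_. 1" a "{..<n}"] by simp

text \<open>Change of variables along a map that is at most m-to-one.\<close>

lemma sum_fibers_le:
  fixes F :: "'b \<Rightarrow> real"
  assumes "finite A" "finite B" "p ` A \<subseteq> B" "\<And>b. b \<in> B \<Longrightarrow> F b \<ge> 0"
    and "\<And>b. b \<in> B \<Longrightarrow> real (card {x \<in> A. p x = b}) \<le> m"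
  shows "(\<Sum>x\<in>A. F (p x)) \<le> m * (\<Sum>b\<in>B. F b)"
proof -
  have "(\<Sum>x\<in>A. F (p x)) = (\<Sum>b\<in>B. \<Sum>x\<in>{x \<in> A. p x = b}. F (p x))"
    using assms(1-3) by (intro sum.group[symmetric]) auto
  also have "\<dots> = (\<Sum>b\<in>B. real (card {x \<in> A. p x = b}) * F b)"
    by (intro sum.cong) auto
  also have "\<dots> \<le> (\<Sum>b\<in>B. m * F b)"
    using assms by (intro sum_mono mult_right_mono) auto
  finally show ?thesis by (simp add: sum_distrib_left)
qed

text \<open>The variance identity: it reduces the deviation from the mean to differences between
  pairs of points, which can be joined by paths.\<close>

lemma sum_pairs_diff_squared:
  fixes u :: "'a \<Rightarrow> real"
  assumes "finite Q"
  shows "(\<Sum>x\<in>Q. \<Sum>y\<in>Q. (u y - u x)\<^sup>2) = 2 * card Q * (\<Sum>x\<in>Q. (u x)\<^sup>2) - 2 * (\<Sum>x\<in>Q. u x)\<^sup>2"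
proof -
  have "(\<Sum>x\<in>Q. \<Sum>y\<in>Q. (u y - u x)\<^sup>2)
      = (\<Sum>x\<in>Q. (\<Sum>y\<in>Q. (u y)\<^sup>2) + card Q * (u x)\<^sup>2 - 2 * (u x * (\<Sum>y\<in>Q. u y)))"
    by (intro sum.cong refl)
       (simp add: power2_diff sum.distrib sum_subtractf sum_distrib_left mult_ac)
  also have "\<dots> = 2 * card Q * (\<Sum>x\<in>Q. (u x)\<^sup>2) - 2 * ((\<Sum>x\<in>Q. u x) * (\<Sum>x\<in>Q. u x))"
    by (simp add: sum.distrib sum_subtractf sum_distrib_right flip: sum_distrib_left)
  finally show ?thesis by (simp add: power2_eq_square)
qed

section \<open>Graphs mapped roughly isometrically into the group\<close>

definition energy :: "('a \<Rightarrow> 'a \<Rightarrow> bool) \<Rightarrow> ('a \<Rightarrow> real) \<Rightarrow> 'a \<Rightarrow> real" where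
  "energy E u x = (\<Sum>y\<in>{y. E x y}. (u y - u x)\<^sup>2)"

lemma energy_nonneg [simp]: "0 \<le> energy E u x"
  unfolding energy_def by (intro sum_nonneg) auto

text \<open>The rough isometry in integer form. The number \<open>2 * L + 1\<close> is the largest
  distance between the images of two vertices that are chosen, each with error \<open>L\<close>,
  over adjacent group elements; \<open>hop\<close> says that such vertices are close in the
  graph.\<close>

locale rough_graph = growth_group S D c\<^sub>1 c\<^sub>2
  for S :: "'g::group_add set" and D :: nat and c\<^sub>1 c\<^sub>2 :: real +
  fixes E :: "'a \<Rightarrow> 'a \<Rightarrow> bool" and \<phi> :: "'a \<Rightarrow> 'g" and L M c \<Delta> :: nat
  assumes graph: "graph E"
    and degree: "\<And>x. card {y. E x y} \<le> \<Delta>"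
    and stretch: "\<And>x y. E x y \<Longrightarrow> len (- \<phi> x + \<phi> y) \<le> L"
    and dense: "\<And>g. \<exists>x. len (- g + \<phi> x) \<le> L"
    and finite_fiber: "\<And>g. finite {x. \<phi> x = g}"
    and card_fiber: "\<And>g. card {x. \<phi> x = g} \<le> M"
    and hop: "\<And>x y. len (- \<phi> x + \<phi> y) \<le> 2 * L + 1 \<Longrightarrow> gdist E x y \<le> c"
    and L: "L \<ge> 1"
begin

lemma E_sym: "E x y \<Longrightarrow> E y x"
  using graph by (auto simp: graph_def)

lemma finite_nbrs [simp]: "finite {y. E x y}"
  using graph by (auto simp: graph_def)

lemma ex_walk: "\<exists>n. walk E n x y"
  using graph by (auto simp: graph_def)

lemma vimage_fibers:
  assumes "finite A"
  shows "finite {x. \<phi> x \<in> A}" "card {x. \<phi> x \<in> A} \<le> M * card A"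
proof -
  have eq: "{x. \<phi> x \<in> A} = (\<Union>g\<in>A. {x. \<phi> x = g})" by auto
  show "finite {x. \<phi> x \<in> A}" unfolding eq using assms finite_fiber by auto
  have "card {x. \<phi> x \<in> A} \<le> (\<Sum>g\<in>A. card {x. \<phi> x = g})" unfolding eq by (rule card_UN_le[OF assms])
  also have "\<dots> \<le> (\<Sum>g\<in>A. M)" by (intro sum_mono card_fiber)
  finally show "card {x. \<phi> x \<in> A} \<le> M * card A" by (simp add: mult.commute)
qed

definition pull :: "'g \<Rightarrow> real \<Rightarrow> 'a set" where
  "pull g r = {x. \<phi> x \<in> gball g r}"

lemma finite_pull [simp]: "finite (pull g r)"
  unfolding pull_def by (rule vimage_fibers) simp

lemma card_pull: "card (pull g r) \<le> M * card (gball 0 r)"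
  using vimage_fibers(2)[of "gball g r"] by (simp add: pull_def card_gball[of g])

lemma mem_pull: "x \<in> pull g r \<longleftrightarrow> real (len (- g + \<phi> x)) \<le> r"
  by (simp add: pull_def gball_def)

lemma pull_trans:
  fixes r s t :: real
  assumes "x \<in> pull g r" "len (- \<phi> x + \<phi> y) \<le> s" "r + s \<le> t"
  shows "y \<in> pull g t"
  using assms len_triangle[of g "\<phi> y" "\<phi> x"] by (force simp: mem_pull)

lemma walk_stretch: "walk E n x y \<Longrightarrow> len (- \<phi> x + \<phi> y) \<le> n * L"
proof (induction n arbitrary: y)
  case 0
  then show ?case by (auto simp: walk_def)
next
  case (Suc n)
  from Suc.prems obtain z where "walk E n x z" "E z y" by (rule walk_SucD)
  then show ?case using Suc.IH[of z] stretch[of z y] len_triangle[of "\<phi> x" "\<phi> y" "\<phi> z"] by simp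
qed

lemma gdist_stretch:
  assumes "gdist E x y \<le> n"
  shows "len (- \<phi> x + \<phi> y) \<le> n * L"
proof -
  have "gdist E x y * L \<le> n * L" using assms by (rule mult_right_mono) simp
  then show ?thesis using walk_stretch[OF walk_gdist[OF ex_walk[of x y]]] by linarith
qed

definition near :: "'a \<Rightarrow> 'a set" where "near x = {z. gdist E x z \<le> c}"

definition near_bound :: nat where "near_bound = M * card (gball 0 (c * L))"

lemma near_subset: "near x \<subseteq> pull (\<phi> x) (c * L)"
proof
  fix z assume "z \<in> near x"
  then have "len (- \<phi> x + \<phi> z) \<le> c * L" unfolding near_def using gdist_stretch by blast
  then have "real (len (- \<phi> x + \<phi> z)) \<le> real (c * L)" by (rule of_nat_mono)
  then show "z \<in> pull (\<phi> x) (c * L)" by (simp add: mem_pull)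
qed

lemma finite_near [simp]: "finite (near x)"
  by (rule finite_subset[OF near_subset finite_pull])

lemma card_near_converse:
  "finite {x. z \<in> near x}" "card {x. z \<in> near x} \<le> near_bound"
proof -
  have sub: "{x. z \<in> near x} \<subseteq> pull (\<phi> z) (c * L)"
    using near_subset by (force simp: mem_pull len_commute[of "\<phi> z"])
  then show "finite {x. z \<in> near x}" by (rule finite_subset) simp
  show "card {x. z \<in> near x} \<le> near_bound"
    using card_mono[OF finite_pull sub] card_pull[of "\<phi> z" "c * L"] by (simp add: near_bound_def)
qed

definition near_energy :: "('a \<Rightarrow> real) \<Rightarrow> 'a \<Rightarrow> real" where
  "near_energy u x = (\<Sum>z\<in>near x. energy E u z)"

lemma near_energy_nonneg [simp]: "0 \<le> near_energy u x"
  unfolding near_energy_def by (intro sum_nonneg) auto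

text \<open>A shortest path from \<open>x\<close> to \<open>y\<close> has at most \<open>c\<close>
  edges and stays in \<open>near x\<close>. Each squared increment is bounded crudely by the whole
  of \<open>near_energy u x\<close>; one factor \<open>c\<close> comes from Cauchy-Schwarz and one
  from the number of edges.\<close>

lemma hop_le:
  assumes "len (- \<phi> x + \<phi> y) \<le> 2 * L + 1"
  shows "(u y - u x)\<^sup>2 \<le> (real c)\<^sup>2 * near_energy u x"
proof -
  define m where "m = gdist E x y"
  have m: "m \<le> c" using hop[OF assms] by (simp add: m_def)
  obtain f where f: "f 0 = x" "f m = y" "\<forall>i<m. E (f i) (f (Suc i))"
    using walk_gdist[OF ex_walk[of x y]] unfolding walk_def m_def by auto
  have step: "(u (f (Suc i)) - u (f i))\<^sup>2 \<le> near_energy u x" if "i < m" for i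
  proof -
    have "(u (f (Suc i)) - u (f i))\<^sup>2 \<le> energy E u (f i)"
      unfolding energy_def using f(3) that by (intro member_le_sum) auto
    also have "walk E i x (f i)" unfolding walk_def using f that by (intro exI[of _ f]) auto
    then have "f i \<in> near x" using walk_le m that by (fastforce simp: near_def)
    then have "energy E u (f i) \<le> near_energy u x"
      unfolding near_energy_def by (intro member_le_sum) auto
    finally show ?thesis .
  qed
  have "u y - u x = (\<Sum>i<m. u (f (Suc i)) - u (f i))"
    using f sum_lessThan_telescope[of "\<lambda>i. u (f i)" m] by simp
  then have "(u y - u x)\<^sup>2 \<le> m * (\<Sum>i<m. (u (f (Suc i)) - u (f i))\<^sup>2)"
    by (simp only: power2_sum_le)
  also have "\<dots> \<le> m * (\<Sum>i<m. near_energy u x)"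
    using step by (intro mult_left_mono sum_mono) auto
  also have "\<dots> = (real m)\<^sup>2 * near_energy u x" by (simp add: power2_eq_square)
  also have "\<dots> \<le> (real c)\<^sup>2 * near_energy u x"
    using m by (intro mult_right_mono) (auto simp: power_mono)
  finally show ?thesis .
qed

lemma sum_near_energy_le:
  fixes r r' :: real
  assumes "r + c * L \<le> r'"
  shows "(\<Sum>x\<in>pull g r. near_energy u x) \<le> near_bound * (\<Sum>w\<in>pull g r'. energy E u w)"
proof -
  have sub: "near x \<subseteq> pull g r'" if "x \<in> pull g r" for x
  proof
    fix z assume "z \<in> near x"
    then have "len (- \<phi> x + \<phi> z) \<le> c * L" unfolding near_def using gdist_stretch by blast
    then show "z \<in> pull g r'"
      using pull_trans[OF that, of z "c * L" r'] assms of_nat_mono[of _ "c * L"] by fastforce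
  qed
  have "(\<Sum>x\<in>pull g r. near_energy u x)
      = (\<Sum>x\<in>pull g r. \<Sum>z\<in>pull g r'. if z \<in> near x then energy E u z else 0)"
    unfolding near_energy_def
  proof (rule sum.cong[OF refl])
    fix x assume "x \<in> pull g r"
    then show "(\<Sum>z\<in>near x. energy E u z) = (\<Sum>z\<in>pull g r'. if z \<in> near x then energy E u z else 0)"
      by (intro sum.mono_neutral_cong_left) (use sub in auto)
  qed
  also have "\<dots> = (\<Sum>z\<in>pull g r'. \<Sum>x\<in>pull g r. if z \<in> near x then energy E u z else 0)"
    by (rule sum.swap)
  also have "\<dots> \<le> (\<Sum>z\<in>pull g r'. near_bound * energy E u z)"
  proof (rule sum_mono)
    fix z
    have "(\<Sum>x\<in>pull g r. if z \<in> near x then energy E u z else 0)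
        = card {x \<in> pull g r. z \<in> near x} * energy E u z"
      by (simp flip: sum.inter_filter)
    also have "card {x \<in> pull g r. z \<in> near x} \<le> near_bound"
      using card_mono[OF card_near_converse(1), of "{x \<in> pull g r. z \<in> near x}" z] card_near_converse(2)[of z]
      by fastforce
    then have "card {x \<in> pull g r. z \<in> near x} * energy E u z \<le> near_bound * energy E u z"
      by (intro mult_right_mono) auto
    finally show "(\<Sum>x\<in>pull g r. if z \<in> near x then energy E u z else 0) \<le> near_bound * energy E u z" .
  qed
  finally show ?thesis by (simp add: sum_distrib_left)
qed

text \<open>A coarse inverse of \<open>\<phi>\<close>, which carries paths of the group back to the
  graph.\<close>

definition \<psi> :: "'g \<Rightarrow> 'a" where "\<psi> g = (SOME x. len (- g + \<phi> x) \<le> L)"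

lemma \<psi>: "len (- g + \<phi> (\<psi> g)) \<le> L"
  unfolding \<psi>_def by (rule someI_ex[OF dense])

lemma hop_\<psi>:
  assumes "len (- g + h) \<le> 1"
  shows "len (- \<phi> (\<psi> g) + \<phi> (\<psi> h)) \<le> 2 * L + 1"
  using \<psi>[of g] \<psi>[of h] assms len_triangle[of "\<phi> (\<psi> g)" "\<phi> (\<psi> h)" g]
    len_triangle[of g "\<phi> (\<psi> h)" h] len_commute[of g "\<phi> (\<psi> g)"] by linarith

text \<open>The two points are joined by the \<open>\<psi>\<close>-image of a geodesic of the group, whose shape depends only
  on the increment \<open>- \<phi> x + \<phi> y\<close>.\<close>
lemma diff_squared_le:
  assumes "len (- \<phi> x + \<phi> y) \<le> m"
  shows "(u y - u x)\<^sup>2 \<le> (real m + 2) * ((real c)\<^sup>2 * (near_energy u x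
           + (\<Sum>k<m+1. near_energy u (\<psi> (\<phi> x + geod (- \<phi> x + \<phi> y) k)))))"
proof -
  define q where "q k = \<psi> (\<phi> x + geod (- \<phi> x + \<phi> y) k)" for k
  \<comment> \<open>The chain x, q 0, ..., q m, y has m + 2 hops. The first and last hop only
    correct the error \<open>L\<close> of \<open>\<psi>\<close> at the two ends, and
    \<open>q m\<close> lies over \<open>\<phi> y\<close> because the geodesic rests at its
    endpoint.\<close>
  define f where "f k = (if k = 0 then x else if k \<le> m + 1 then q (k - 1) else y)" for k
  have q0: "q 0 = \<psi> (\<phi> x)" and qm: "q m = \<psi> (\<phi> y)"
    unfolding q_def using assms by (simp_all add: geod flip: add.assoc)
  have hops: "len (- \<phi> (f k) + \<phi> (f (Suc k))) \<le> 2 * L + 1" if k: "k < m + 2" for k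
  proof -
    consider "k = 0" | "k = m + 1" | j where "k = Suc j" "j < m" using k by (cases k; cases "k = m + 1") auto
    then show ?thesis
    proof cases
      case 1
      then show ?thesis using \<psi>[of "\<phi> x"] by (simp add: f_def q0)
    next
      case 2
      then show ?thesis using \<psi>[of "\<phi> y"] len_commute[of "\<phi> y"] by (simp add: f_def qm)
    next
      case 3
      then show ?thesis
        using hop_\<psi>[of "\<phi> x + geod (- \<phi> x + \<phi> y) j" "\<phi> x + geod (- \<phi> x + \<phi> y) (Suc j)"]
          geod(3)[of "- \<phi> x + \<phi> y" j]
        by (simp add: f_def q_def)
    qed
  qed
  have "u y - u x = (\<Sum>k<m+2. u (f (Suc k)) - u (f k))"
    using sum_lessThan_telescope[of "\<lambda>i. u (f i)" "m + 2"] by (simp add: f_def)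
  then have "(u y - u x)\<^sup>2 \<le> real (m + 2) * (\<Sum>k<m+2. (u (f (Suc k)) - u (f k))\<^sup>2)"
    by (simp only: power2_sum_le)
  also have "\<dots> \<le> (real m + 2) * (\<Sum>k<m+2. (real c)\<^sup>2 * near_energy u (f k))"
  proof (rule mult_mono)
    show "(\<Sum>k<m+2. (u (f (Suc k)) - u (f k))\<^sup>2) \<le> (\<Sum>k<m+2. (real c)\<^sup>2 * near_energy u (f k))"
      using hops by (intro sum_mono hop_le) blast
  qed (simp_all add: sum_nonneg del: sum.lessThan_Suc)
  also have "(\<Sum>k<m+2. (real c)\<^sup>2 * near_energy u (f k)) = (real c)\<^sup>2 * (\<Sum>k<Suc (m+1). near_energy u (f k))"
    by (simp add: sum_distrib_left distrib_left)
  also have "(\<Sum>k<Suc (m+1). near_energy u (f k)) = near_energy u x + (\<Sum>k<m+1. near_energy u (q k))"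
    by (subst sum.lessThan_Suc_shift) (simp add: f_def)
  finally show ?thesis by (simp add: q_def)
qed

text \<open>All \<open>x\<close> that are sent to the same \<open>z\<close> satisfy:
  \<open>\<phi> x + h\<close> lies within \<open>L\<close> of \<open>\<phi> z\<close>. Right
  translation by \<open>h\<close> is injective on the group and fibers of \<open>\<phi>\<close> have
  at most \<open>M\<close> points, so the multiplicity does not depend on \<open>h\<close>.\<close>

lemma sum_near_energy_translate:
  fixes r r' s :: real
  assumes "len h \<le> s" "r + s + L \<le> r'"
  shows "(\<Sum>x\<in>pull g r. near_energy u (\<psi> (\<phi> x + h)))
    \<le> real (M * card (gball 0 L)) * (\<Sum>z\<in>pull g r'. near_energy u z)"
proof (rule sum_fibers_le)
  show "(\<lambda>x. \<psi> (\<phi> x + h)) ` pull g r \<subseteq> pull g r'"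
  proof
    fix z assume "z \<in> (\<lambda>x. \<psi> (\<phi> x + h)) ` pull g r"
    then obtain x where x: "x \<in> pull g r" "z = \<psi> (\<phi> x + h)" by auto
    have "len (- \<phi> x + \<phi> z) \<le> len h + L"
      using len_triangle[of "\<phi> x" "\<phi> z" "\<phi> x + h"] \<psi>[of "\<phi> x + h"] x(2) by (simp flip: add.assoc)
    then show "z \<in> pull g r'" using assms by (intro pull_trans[OF x(1), of z "s + L"]) auto
  qed
  fix z
  have "card {x \<in> pull g r. \<psi> (\<phi> x + h) = z} \<le> card {x. \<phi> x \<in> (\<lambda>a. a - h) ` gball (\<phi> z) L}"
  proof (intro card_mono vimage_fibers)
    show "{x \<in> pull g r. \<psi> (\<phi> x + h) = z} \<subseteq> {x. \<phi> x \<in> (\<lambda>a. a - h) ` gball (\<phi> z) (real L)}"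
    proof safe
      fix x assume "z = \<psi> (\<phi> x + h)"
      then show "\<phi> x \<in> (\<lambda>a. a - h) ` gball (\<phi> (\<psi> (\<phi> x + h))) (real L)"
        using \<psi>[of "\<phi> x + h"]
        by (intro image_eqI[of _ _ "\<phi> x + h"]) (auto simp: gball_def len_commute[of "\<phi> (\<psi> (\<phi> x + h))"])
    qed
  qed simp
  also have "\<dots> \<le> M * card ((\<lambda>a. a - h) ` gball (\<phi> z) L)" by (rule vimage_fibers) simp
  also have "\<dots> \<le> M * card (gball 0 L)"
    using card_image_le[OF finite_gball, of "\<lambda>a. a - h" "\<phi> z" L] card_gball[of "\<phi> z"] by simp
  finally show "real (card {x \<in> pull g r. \<psi> (\<phi> x + h) = z}) \<le> real (M * card (gball 0 L))"
    by (rule of_nat_mono)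
qed auto

text \<open>The sum over \<open>y\<close> is replaced by a sum over the increments \<open>h\<close>
  in the ball of radius 2 r, each of which occurs for at most \<open>M\<close> vertices
  \<open>y\<close>. For fixed \<open>h\<close> and time \<open>k\<close> the sum over
  \<open>x\<close> is then a translate. Cauchy-Schwarz contributes the factor m + 2 and the times
  contribute m + 1. The radius 3 r + L is r for \<open>x\<close>, 2 r for the geodesic and L for
  \<open>\<psi>\<close>.\<close>

lemma sum_pairs_le:
  fixes r W :: real and u :: "'a \<Rightarrow> real" and g :: 'g
  assumes r: "r \<ge> 1" and m: "m = nat \<lfloor>2 * r\<rfloor>"
  defines "W \<equiv> (\<Sum>z\<in>pull g (3 * r + real L). near_energy u z)"
  shows "(\<Sum>x\<in>pull g r. \<Sum>y\<in>pull g r. (u y - u x)\<^sup>2) \<le> (real m + 2) * (real c)\<^sup>2 *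
     ((real (card (pull g r)) + (real m + 1) * (real M * real (card (gball 0 (2 * r))) * (real M * real (card (gball 0 L))))) * W)"
proof -
  let ?Q = "pull g r" and ?V = "gball 0 (2 * r)"
  define F where "F k x h = near_energy u (\<psi> (\<phi> x + geod h k))" for k x h
  have inc: "- \<phi> x + \<phi> y \<in> ?V" if "x \<in> ?Q" "y \<in> ?Q" for x y
    using that len_triangle[of "\<phi> x" "\<phi> y" g] len_commute[of g "\<phi> x"]
    by (auto simp: gball_def mem_pull)
  let ?X = "(real m + 1) * (real M * real (card ?V) * (real M * real (card (gball 0 L)))) * W"
  have "(\<Sum>x\<in>?Q. \<Sum>y\<in>?Q. (u y - u x)\<^sup>2)
     \<le> (\<Sum>x\<in>?Q. \<Sum>y\<in>?Q. (real m + 2) * ((real c)\<^sup>2 * (near_energy u x + (\<Sum>k<m+1. F k x (- \<phi> x + \<phi> y)))))"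
    unfolding F_def using inc r
    by (intro sum_mono diff_squared_le) (force simp: gball_def m le_nat_iff le_floor_iff)
  also have "\<dots> = (real m + 2) * ((real c)\<^sup>2 * (card ?Q * (\<Sum>x\<in>?Q. near_energy u x)
      + (\<Sum>x\<in>?Q. \<Sum>y\<in>?Q. \<Sum>k<m+1. F k x (- \<phi> x + \<phi> y))))"
    by (simp only: sum_distrib_left[symmetric] sum.distrib) (simp flip: sum_distrib_left)
  finally have total: "(\<Sum>x\<in>?Q. \<Sum>y\<in>?Q. (u y - u x)\<^sup>2) \<le> \<dots>" .
  have "(\<Sum>x\<in>?Q. \<Sum>y\<in>?Q. \<Sum>k<m+1. F k x (- \<phi> x + \<phi> y))
      = (\<Sum>x\<in>?Q. \<Sum>k<m+1. \<Sum>y\<in>?Q. F k x (- \<phi> x + \<phi> y))"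
    by (intro sum.cong refl sum.swap)
  also have "\<dots> = (\<Sum>k<m+1. \<Sum>x\<in>?Q. \<Sum>y\<in>?Q. F k x (- \<phi> x + \<phi> y))"
    by (rule sum.swap)
  also have "\<dots> \<le> (\<Sum>k<m+1. \<Sum>x\<in>?Q. M * (\<Sum>h\<in>?V. F k x h))"
  proof (intro sum_mono)
    fix k x assume x: "x \<in> ?Q"
    show "(\<Sum>y\<in>?Q. F k x (- \<phi> x + \<phi> y)) \<le> M * (\<Sum>h\<in>?V. F k x h)"
    proof (rule sum_fibers_le[where p = "\<lambda>y. - \<phi> x + \<phi> y" and F = "F k x"])
      fix h
      have "card {y \<in> ?Q. - \<phi> x + \<phi> y = h} \<le> card {y. \<phi> y = \<phi> x + h}"
        using finite_fiber by (intro card_mono) (auto simp flip: add.assoc)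
      then show "real (card {y \<in> ?Q. - \<phi> x + \<phi> y = h}) \<le> real M"
        using card_fiber[of "\<phi> x + h"] by linarith
    qed (use inc x in \<open>auto simp: F_def\<close>)
  qed
  also have "\<dots> = (\<Sum>k<m+1. M * (\<Sum>h\<in>?V. \<Sum>x\<in>?Q. F k x h))"
    by (simp only: sum_distrib_left[symmetric] sum.swap[of _ ?V ?Q])
  also have "\<dots> \<le> (\<Sum>k<m+1. M * (\<Sum>h\<in>?V. real (M * card (gball 0 L)) * W))"
    unfolding F_def W_def
  proof (intro sum_mono mult_left_mono sum_near_energy_translate)
    fix h k assume "h \<in> ?V"
    then show "real (len (geod h k)) \<le> 2 * r" using geod(4)[of h k] by (simp add: gball_def)
  qed auto
  also have "\<dots> = (real m + 1) * (real M * real (card ?V) * (real M * real (card (gball 0 L)))) * W"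
    by (simp add: algebra_simps)
  finally have X: "(\<Sum>x\<in>?Q. \<Sum>y\<in>?Q. \<Sum>k<m+1. F k x (- \<phi> x + \<phi> y)) \<le> ?X"
    by simp
  have "(\<Sum>x\<in>?Q. near_energy u x) \<le> W"
    unfolding W_def using r by (intro sum_mono2) (auto simp: mem_pull)
  then have "card ?Q * (\<Sum>x\<in>?Q. near_energy u x) \<le> card ?Q * W"
    by (rule mult_left_mono) simp
  from add_mono[OF this X] have "(real m + 2) * ((real c)\<^sup>2 * (card ?Q * (\<Sum>x\<in>?Q. near_energy u x)
      + (\<Sum>x\<in>?Q. \<Sum>y\<in>?Q. \<Sum>k<m+1. F k x (- \<phi> x + \<phi> y))))
    \<le> (real m + 2) * ((real c)\<^sup>2 * (card ?Q * W + ?X))"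
    by (intro mult_left_mono) auto
  with total show ?thesis by (simp add: distrib_right mult.assoc)
qed

text \<open>The balls of radius \<open>L\<close> about the images of \<open>pull g r\<close> cover
  the group ball of radius r / 2: the vertex \<open>\<psi> h\<close> over a point \<open>h\<close>
  of that ball is displaced by at most L \<le> r / 2.\<close>

lemma card_pull_lower:
  fixes r :: real
  assumes "r \<ge> real (2 * L)"
  shows "c\<^sub>1 * (r / 2) ^ D \<le> real (card (gball 0 L)) * card (pull g r)"
proof -
  have r: "r / 2 \<ge> 1" "r - L \<ge> r / 2" using assms L by auto
  have "c\<^sub>1 * (r / 2) ^ D \<le> card (gball g (r / 2))" using gball_lower r by blast
  also have "card (gball g (r / 2)) \<le> card (\<Union>x\<in>pull g r. gball (\<phi> x) L)"
  proof (intro card_mono finite_UN_I subsetI)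
    fix h assume "h \<in> gball g (r / 2)"
    then have "\<psi> h \<in> pull g r"
      using len_triangle[of g "\<phi> (\<psi> h)" h] \<psi>[of h] r by (simp add: mem_pull gball_def)
    moreover have "h \<in> gball (\<phi> (\<psi> h)) L" using \<psi>[of h] by (simp add: gball_def len_commute[of _ h])
    ultimately show "h \<in> (\<Union>x\<in>pull g r. gball (\<phi> x) L)" by auto
  qed auto
  also have "card (\<Union>x\<in>pull g r. gball (\<phi> x) L) \<le> (\<Sum>x\<in>pull g r. card (gball (\<phi> x) L))"
    by (rule card_UN_le) simp
  also have "\<dots> = card (gball 0 L) * card (pull g r)" by (simp add: card_gball[of "\<phi> _"])
  finally show ?thesis by simp
qed

text \<open>Only translation invariance and the volume bounds enter. The last term is the number of
  points times the squared mean; nonemptiness is included so that this mean makes sense.\<close>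

lemma poincare:
  "\<exists>C r\<^sub>0 :: real. C > 0 \<and> (\<forall>r\<ge>r\<^sub>0. \<forall>g u. pull g r \<noteq> {} \<and> (\<Sum>x\<in>pull g r. (u x)\<^sup>2)
      \<le> C * r\<^sup>2 * (\<Sum>w\<in>pull g (5 * r). energy E u w) + (\<Sum>x\<in>pull g r. u x)\<^sup>2 / card (pull g r))"
proof -
  define V where "V = real (card (gball 0 L))"
  define A where "A = 4 * (real c)\<^sup>2 * (M * c\<^sub>2 + 3 * (M * (c\<^sub>2 * 2 ^ D) * (M * V))) * near_bound"
  define C where "C = A * (V * 2 ^ D / c\<^sub>1) + 1"
  have V: "V \<ge> 1" unfolding V_def using card_gt_0_iff[of "gball 0 (real L)"] gball_center[of L 0] by fastforce
  have A: "A \<ge> 0" unfolding A_def using c\<^sub>2 V by auto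
  have main: "pull g r \<noteq> {} \<and> (\<Sum>x\<in>pull g r. (u x)\<^sup>2)
      \<le> C * r\<^sup>2 * (\<Sum>w\<in>pull g (5 * r). energy E u w) + (\<Sum>x\<in>pull g r. u x)\<^sup>2 / card (pull g r)"
    if r: "r \<ge> real (2 * L + c * L)" for r :: real and g :: 'g and u :: "'a \<Rightarrow> real"
  proof -
    define Q where "Q = pull g r"
    define m where "m = nat \<lfloor>2 * r\<rfloor>"
    define W where "W = (\<Sum>z\<in>pull g (3 * r + L). near_energy u z)"
    define Z where "Z = (\<Sum>w\<in>pull g (5 * r). energy E u w)"
    have cL: "real (c * L) \<ge> 0" by (rule of_nat_0_le_iff)
    have r1: "r \<ge> 1" "r \<ge> real (2 * L)" "r \<ge> real (c * L)" using r L cL by linarith+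
    have m: "real m \<le> 2 * r" using r1 unfolding m_def by linarith
    have low: "c\<^sub>1 * (r / 2) ^ D \<le> V * card Q" unfolding V_def Q_def by (rule card_pull_lower[OF r1(2)])
    have pos: "0 < c\<^sub>1 * (r / 2) ^ D" using c\<^sub>1 r1 by simp
    have Q: "card Q > 0"
    proof (rule ccontr)
      assume "\<not> card Q > 0"
      then show False using low pos by simp
    qed
    \<comment> \<open>The radius 3 r + L, enlarged by c L for \<open>near_energy\<close>, stays
      below 5 r because r dominates both constants.\<close>
    have W: "W \<le> near_bound * Z" unfolding W_def Z_def using r1 by (intro sum_near_energy_le) auto
    have Z: "0 \<le> Z" unfolding Z_def by (intro sum_nonneg) auto
    have "(\<Sum>x\<in>Q. \<Sum>y\<in>Q. (u y - u x)\<^sup>2) \<le> (real m + 2) * (real c)\<^sup>2 *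
     ((real (card Q) + (real m + 1) * (M * card (gball 0 (2 * r)) * (M * V))) * W)"
      unfolding Q_def W_def V_def using sum_pairs_le[OF r1(1) m_def, of u g] by simp
    also have "\<dots> \<le> (4 * r) * (real c)\<^sup>2 * ((M * (c\<^sub>2 * r ^ D) + (3 * r) * (M * (c\<^sub>2 * (2 * r) ^ D) * (M * V))) * (near_bound * Z))"
    proof -
      have "real (card Q) \<le> M * real (card (gball 0 r))" unfolding Q_def using card_pull[of g r]
        by (metis of_nat_mono of_nat_mult)
      also have "\<dots> \<le> M * (c\<^sub>2 * r ^ D)" using gball_upper r1 by (intro mult_left_mono) auto
      finally have "real (card Q) \<le> M * (c\<^sub>2 * r ^ D)" .
      moreover define X where "X = c\<^sub>2 * (2 * r) ^ D"
      moreover have X: "real (card (gball 0 (2 * r))) \<le> X"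
        unfolding X_def by (rule gball_upper) (use r1 in simp)
      moreover have "W \<ge> 0" unfolding W_def by (intro sum_nonneg) auto
      moreover have "X \<ge> 0" using X by linarith
      ultimately show ?thesis using m r1 W Z c\<^sub>2 V unfolding X_def[symmetric]
        by (intro mult_mono add_mono) (auto intro: mult_left_mono)
    qed
    also have "\<dots> \<le> A * r ^ (D + 2) * Z"
    proof -
      have *: "r \<le> r\<^sup>2" "0 \<le> r ^ D" using r1 by (simp_all add: power2_eq_square)
      have "(4 * r) * (real c)\<^sup>2 * ((M * (c\<^sub>2 * r ^ D) + (3 * r) * (M * (c\<^sub>2 * (2 * r) ^ D) * (M * V))) * (near_bound * Z))
        = 4 * (real c)\<^sup>2 * (M * c\<^sub>2 * (r * r ^ D) + 3 * (M * (c\<^sub>2 * 2 ^ D) * (M * V)) * (r\<^sup>2 * r ^ D)) * near_bound * Z"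
        by (simp add: algebra_simps power2_eq_square power_mult_distrib)
      also have "\<dots> \<le> 4 * (real c)\<^sup>2 * (M * c\<^sub>2 * (r\<^sup>2 * r ^ D) + 3 * (M * (c\<^sub>2 * 2 ^ D) * (M * V)) * (r\<^sup>2 * r ^ D)) * near_bound * Z"
        using * Z c\<^sub>2 by (intro mult_right_mono mult_left_mono[of _ _ "4 * (real c)\<^sup>2"] add_mono order_refl
            mult_left_mono[of "r * r ^ D"]) auto
      also have "\<dots> = A * r ^ (D + 2) * Z"
        unfolding A_def by (simp add: algebra_simps power2_eq_square)
      finally show ?thesis .
    qed
    finally have "2 * card Q * (\<Sum>x\<in>Q. (u x)\<^sup>2) - 2 * (\<Sum>x\<in>Q. u x)\<^sup>2 \<le> A * r ^ (D + 2) * Z"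
      using sum_pairs_diff_squared[of Q u] by (simp add: Q_def)
    \<comment> \<open>Of r^(D+2), the part r^D is traded for the volume of \<open>Q\<close> by the
      lower bound \<open>low\<close>; this cancels the factor 2 |Q| of the variance identity and
      leaves r^2.\<close>
    also have "A * r ^ (D + 2) * Z = A * r\<^sup>2 * (2 ^ D / c\<^sub>1) * Z * (c\<^sub>1 * (r / 2) ^ D)"
      using c\<^sub>1 by (simp add: power_add power_divide power2_eq_square field_simps)
    also have "\<dots> \<le> A * r\<^sup>2 * (2 ^ D / c\<^sub>1) * Z * (V * card Q)"
      using low A Z c\<^sub>1 r1 by (intro mult_left_mono) auto
    also have "\<dots> \<le> (C * r\<^sup>2 * Z) * (2 * card Q)"
    proof -
      have nn: "0 \<le> r\<^sup>2 * Z * real (card Q)" using Z by auto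
      have c: "0 \<le> A * (V * 2 ^ D / c\<^sub>1)" using A V c\<^sub>1 by auto
      have "A * r\<^sup>2 * (2 ^ D / c\<^sub>1) * Z * (V * card Q) = A * (V * 2 ^ D / c\<^sub>1) * (r\<^sup>2 * Z * real (card Q))"
        by simp
      also have "\<dots> \<le> (2 * C) * (r\<^sup>2 * Z * real (card Q))"
        using nn c unfolding C_def by (intro mult_right_mono) auto
      finally show ?thesis by simp
    qed
    finally have "(\<Sum>x\<in>Q. (u x)\<^sup>2) \<le> C * r\<^sup>2 * Z + (\<Sum>x\<in>Q. u x)\<^sup>2 / card Q"
      using Q by (simp add: field_simps)
    then show ?thesis using Q by (auto simp: Q_def Z_def)
  qed
  have "C > 0" unfolding C_def using A V c\<^sub>1 by (simp add: add_nonneg_pos)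
  then show ?thesis using main by blast
qed

end

subsection \<open>The Caccioppoli inequality and Whitney coverings\<close>

text \<open>The equation is tested with \<theta>^2 u. The support condition ensures that the sum
  over \<open>F\<close> contains every neighbor of a vertex where \<theta> is nonzero, so the full
  Laplacian appears there.\<close>

lemma caccioppoli:
  fixes u \<theta> :: "'a \<Rightarrow> real"
  assumes sym: "\<And>x y. E x y \<Longrightarrow> E y x" and F: "finite F"
    and supp: "\<And>x. \<theta> x \<noteq> 0 \<Longrightarrow> x \<in> F \<and> {y. E x y} \<subseteq> F"
    and harm: "\<And>x. laplacian E u x = 0"
  shows "(\<Sum>x\<in>F. (\<theta> x)\<^sup>2 * energy E u x)
    \<le> 4 * (\<Sum>x\<in>F. (\<Sum>y\<in>{y \<in> F. E x y}. (\<theta> y - \<theta> x)\<^sup>2) * (u x)\<^sup>2)"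
proof -
  define I where "I f = (\<Sum>x\<in>F. \<Sum>y\<in>{y \<in> F. E x y}. f x y)" for f :: "'a \<Rightarrow> 'a \<Rightarrow> real"
  have I_sym: "I f = I (\<lambda>x y. f y x)" for f
  proof -
    have *: "I f = (\<Sum>x\<in>F. \<Sum>y\<in>F. if E x y then f x y else 0)" for f
      unfolding I_def using F by (intro sum.cong[OF refl]) (rule sum.inter_filter)
    show ?thesis unfolding * by (subst sum.swap) (use sym in \<open>auto intro!: sum.cong\<close>)
  qed
  have I_add: "I (\<lambda>x y. f x y + g x y) = I f + I g" for f g
    unfolding I_def by (simp add: sum.distrib)
  have I_scale: "I (\<lambda>x y. k * f x y) = k * I f" for f k
    unfolding I_def by (simp add: sum_distrib_left)
  have I_mono: "I f \<le> I g" if "\<And>x y. f x y \<le> g x y" for f g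
    unfolding I_def using that by (intro sum_mono)
  have nbrs: "{y \<in> F. E x y} = {y. E x y}" if "\<theta> x \<noteq> 0" for x
    using supp[OF that] by auto
  have zero: "I (\<lambda>x y. (\<theta> x)\<^sup>2 * u x * (u y - u x)) = 0"
    unfolding I_def
  proof (rule sum.neutral, rule ballI)
    fix x
    show "(\<Sum>y\<in>{y \<in> F. E x y}. (\<theta> x)\<^sup>2 * u x * (u y - u x)) = 0"
      using harm[of x] nbrs[of x] by (cases "\<theta> x = 0") (auto simp: laplacian_def simp flip: sum_distrib_left)
  qed
  \<comment> \<open>An exact discrete identity: up to two terms that are multiples of the equation
    at x and at y, and vanish after summation, the squared increment of \<theta> u is u(x) u(y)
    times the squared increment of \<theta>.\<close>
  have "I (\<lambda>x y. (\<theta> y * u y - \<theta> x * u x)\<^sup>2)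
      = I (\<lambda>x y. (- 1) * ((\<theta> x)\<^sup>2 * u x * (u y - u x)) + ((- 1) * ((\<theta> y)\<^sup>2 * u y * (u x - u y)) + u x * u y * (\<theta> y - \<theta> x)\<^sup>2))"
    by (intro arg_cong[of _ _ I] ext) (simp add: power2_eq_square algebra_simps)
  also have "\<dots> = I (\<lambda>x y. u x * u y * (\<theta> y - \<theta> x)\<^sup>2)"
    unfolding I_add I_scale using zero I_sym[of "\<lambda>x y. (\<theta> x)\<^sup>2 * u x * (u y - u x)"] by simp
  also have "\<dots> \<le> I (\<lambda>x y. (1/2) * ((\<theta> y - \<theta> x)\<^sup>2 * (u x)\<^sup>2) + (1/2) * ((\<theta> y - \<theta> x)\<^sup>2 * (u y)\<^sup>2))"
  proof (rule I_mono)
    fix x y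
    have "u x * u y \<le> (u x)\<^sup>2 / 2 + (u y)\<^sup>2 / 2"
      using sum_squares_bound[of "u x" "u y"] by simp
    from mult_right_mono[OF this, of "(\<theta> y - \<theta> x)\<^sup>2"]
    show "u x * u y * (\<theta> y - \<theta> x)\<^sup>2 \<le> (1/2) * ((\<theta> y - \<theta> x)\<^sup>2 * (u x)\<^sup>2) + (1/2) * ((\<theta> y - \<theta> x)\<^sup>2 * (u y)\<^sup>2)"
      by (simp add: algebra_simps)
  qed
  also have sym': "I (\<lambda>x y. (\<theta> y - \<theta> x)\<^sup>2 * (u y)\<^sup>2) = I (\<lambda>x y. (\<theta> y - \<theta> x)\<^sup>2 * (u x)\<^sup>2)"
    by (subst I_sym) (simp add: power2_commute)
  then have "I (\<lambda>x y. (1/2) * ((\<theta> y - \<theta> x)\<^sup>2 * (u x)\<^sup>2) + (1/2) * ((\<theta> y - \<theta> x)\<^sup>2 * (u y)\<^sup>2))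
     = I (\<lambda>x y. (\<theta> y - \<theta> x)\<^sup>2 * (u x)\<^sup>2)"
    unfolding I_add I_scale by simp
  finally have main: "I (\<lambda>x y. (\<theta> y * u y - \<theta> x * u x)\<^sup>2) \<le> I (\<lambda>x y. (\<theta> y - \<theta> x)\<^sup>2 * (u x)\<^sup>2)" .
  have "(\<Sum>x\<in>F. (\<theta> x)\<^sup>2 * energy E u x) = I (\<lambda>x y. (\<theta> x)\<^sup>2 * (u y - u x)\<^sup>2)"
    unfolding I_def energy_def
  proof (intro sum.cong refl)
    fix x
    show "(\<theta> x)\<^sup>2 * (\<Sum>y\<in>{y. E x y}. (u y - u x)\<^sup>2) = (\<Sum>y\<in>{y \<in> F. E x y}. (\<theta> x)\<^sup>2 * (u y - u x)\<^sup>2)"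
      using nbrs[of x] by (cases "\<theta> x = 0") (auto simp: sum_distrib_left)
  qed
  also have "\<dots> \<le> I (\<lambda>x y. 2 * (\<theta> y * u y - \<theta> x * u x)\<^sup>2 + 2 * ((\<theta> y - \<theta> x)\<^sup>2 * (u y)\<^sup>2))"
  proof (rule I_mono)
    fix x y
    \<comment> \<open>The discrete product rule, with u taken at the other endpoint y; symmetry of
      the sum moves it back to x.\<close>
    have "\<theta> x * (u y - u x) = (\<theta> y * u y - \<theta> x * u x) - (\<theta> y - \<theta> x) * u y" by (simp add: algebra_simps)
    then have "(\<theta> x * (u y - u x))\<^sup>2 \<le> 2 * (\<theta> y * u y - \<theta> x * u x)\<^sup>2 + 2 * ((\<theta> y - \<theta> x) * u y)\<^sup>2"
      using zero_le_power2[of "(\<theta> y * u y - \<theta> x * u x) + (\<theta> y - \<theta> x) * u y"]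
      by (simp only: power2_sum power2_diff) argo
    then show "(\<theta> x)\<^sup>2 * (u y - u x)\<^sup>2 \<le> 2 * (\<theta> y * u y - \<theta> x * u x)\<^sup>2 + 2 * ((\<theta> y - \<theta> x)\<^sup>2 * (u y)\<^sup>2)"
      by (simp add: power_mult_distrib)
  qed
  also have "\<dots> \<le> 4 * I (\<lambda>x y. (\<theta> y - \<theta> x)\<^sup>2 * (u x)\<^sup>2)"
    unfolding I_add I_scale using main sym' by simp
  finally show ?thesis unfolding I_def by (simp add: sum_distrib_right)
qed

text \<open>A maximal family of disjoint balls whose radii are proportional to the distance to the sphere
  of radius \<open>\<rho>\<close>; the constants 3, 15 and 31 are the dilation factors for covering,
  for the Poincare inequality and for counting overlaps.\<close>
locale whitney = growth_group S D c\<^sub>1 c\<^sub>2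
  for S :: "'g::group_add set" and D :: nat and c\<^sub>1 c\<^sub>2 :: real +
  fixes \<rho> R \<eta> :: real
  assumes \<eta>: "0 < \<eta>" "\<eta> \<le> 1 / 30" and gap: "\<eta> * (\<rho> - R) \<ge> 4"
begin

definition t :: "'g \<Rightarrow> real" where "t h = \<rho> - real (len h)"

definition disjoint_balls :: "'g set \<Rightarrow> bool" where
  "disjoint_balls N \<longleftrightarrow> N \<subseteq> gball 0 R \<and> (\<forall>g\<in>N. \<forall>h\<in>N. g \<noteq> h \<longrightarrow> gball g (\<eta> * t g) \<inter> gball h (\<eta> * t h) = {})"

lemma gap_pos: "\<rho> - R > 0"
  using gap \<eta> by (smt (verit) zero_less_mult_iff)

lemma t_lower: "g \<in> gball 0 R \<Longrightarrow> \<rho> - R \<le> t g"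
  by (simp add: gball_def t_def)

lemma t_lipschitz: "\<bar>t g - t h\<bar> \<le> len (- g + h)"
  using len_lipschitz[of g h] by (simp add: t_def)

lemma t_comparable:
  assumes "g \<in> gball 0 R" "h \<in> gball g (15 * \<eta> * t g)"
  shows "t g \<le> 2 * t h" "t h \<le> 3 / 2 * t g"
proof -
  \<comment> \<open>This is where \<eta> \<le> 1/30 comes from: on the largest dilated ball the
    1-Lipschitz function \<open>t\<close> changes by at most half of its value at the
    center.\<close>
  have "15 * \<eta> * t g \<le> 1 / 2 * t g"
    using \<eta> t_lower[OF assms(1)] gap_pos by (intro mult_right_mono) auto
  moreover have "real (len (- g + h)) \<le> 15 * \<eta> * t g" using assms(2) by (simp add: gball_def)
  ultimately show "t g \<le> 2 * t h" "t h \<le> 3 / 2 * t g"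
    using t_lipschitz[of g h] by linarith+
qed

lemma ex_maximal_disjoint_balls:
  obtains N where "disjoint_balls N" "\<And>h. h \<in> gball 0 R \<Longrightarrow> \<exists>g\<in>N. h \<in> gball g (3 * \<eta> * t g)"
proof -
  have "finite {N. disjoint_balls N}"
    by (rule finite_subset[of _ "Pow (gball 0 R)"]) (auto simp: disjoint_balls_def)
  moreover have "{} \<in> {N. disjoint_balls N}" by (simp add: disjoint_balls_def)
  ultimately obtain N where N: "disjoint_balls N" "\<And>N'. disjoint_balls N' \<Longrightarrow> N \<subseteq> N' \<Longrightarrow> N = N'"
    using finite_has_maximal[of "{N. disjoint_balls N}"] by auto
  have "\<exists>g\<in>N. h \<in> gball g (3 * \<eta> * t g)" if h: "h \<in> gball 0 R" for h
  proof (cases "h \<in> N")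
    case True
    have "0 \<le> 3 * \<eta> * t h" using \<eta> t_lower[OF h] gap_pos by (intro mult_nonneg_nonneg) auto
    then show ?thesis using True gball_center by blast
  next
    case False
    then have "\<not> disjoint_balls (insert h N)" using N(2)[of "insert h N"] by auto
    then obtain g where g: "g \<in> N" "gball g (\<eta> * t g) \<inter> gball h (\<eta> * t h) \<noteq> {}"
      using N(1) h unfolding disjoint_balls_def by blast
    then obtain k where k: "k \<in> gball g (\<eta> * t g)" "k \<in> gball h (\<eta> * t h)" by auto
    \<comment> \<open>By maximality the ball about \<open>h\<close> meets one about some
      \<open>g\<close>. Touching balls have t(h) \<le> 2 t(g), so the distance is at most (1 + 2)
      \<eta> t(g), whence the dilation factor 3.\<close>
    have "real (len (- g + h)) \<le> \<eta> * t g + \<eta> * t h"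
      using k len_triangle[of g h k] len_commute[of h k] by (simp add: gball_def)
    moreover have "g \<in> gball 0 R" using N(1) g by (auto simp: disjoint_balls_def)
    moreover have "\<eta> * t g \<le> 1 / 3 * t g" "\<eta> * t h \<le> 1 / 3 * t h"
      using \<eta> t_lower[OF h] t_lower[OF \<open>g \<in> gball 0 R\<close>] gap_pos by (intro mult_right_mono; simp)+
    ultimately have "t h \<le> 2 * t g" using t_lipschitz[of g h] by linarith
    then have "\<eta> * t h \<le> \<eta> * (2 * t g)" using \<eta> by (intro mult_left_mono) auto
    then have "real (len (- g + h)) \<le> 3 * \<eta> * t g" using \<open>real (len (- g + h)) \<le> \<eta> * t g + \<eta> * t h\<close> by simp
    then show ?thesis using g by (auto simp: gball_def)
  qed
  then show ?thesis using that N(1) by blast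
qed

lemma disjoint_balls_finite: "disjoint_balls N \<Longrightarrow> finite N"
  using finite_subset[OF _ finite_gball[of 0 R]] by (auto simp: disjoint_balls_def)

text \<open>On a ball of radius \<eta> t(g) the function \<open>t\<close> is at most 3/2 t(g), while
  the volume is at least \<open>c\<^sub>1\<close> (\<eta> t(g))^D. Each ball therefore contributes
  at least a fixed amount to the sum of t^(-D), and the balls are disjoint. They stay within radius
  (\<rho> + R) / 2 because \<open>t\<close> drops at most by half from its value \<ge> \<rho> - R at
  the center.\<close>

lemma card_disjoint_balls:
  assumes N: "disjoint_balls N"
  shows "card N \<le> (3/2) ^ D / (c\<^sub>1 * \<eta> ^ D) * (\<Sum>h\<in>gball 0 ((\<rho> + R) / 2). 1 / t h ^ D)"
proof -
  define K where "K = (3/2) ^ D / (c\<^sub>1 * \<eta> ^ D)"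
  have K: "K \<ge> 0" unfolding K_def using \<eta> c\<^sub>1 by auto
  have ball: "h \<in> gball 0 ((\<rho> + R) / 2)" "0 < t h" "t h \<le> 3 / 2 * t g"
    if "g \<in> N" "h \<in> gball g (\<eta> * t g)" for g h
  proof -
    have g: "g \<in> gball 0 R" using N that by (auto simp: disjoint_balls_def)
    have "\<eta> * t g \<le> 15 * \<eta> * t g" using \<eta> t_lower[OF g] gap_pos by (intro mult_right_mono) auto
    then have "h \<in> gball g (15 * \<eta> * t g)" using that by (simp add: gball_def)
    from t_comparable[OF g this] t_lower[OF g] gap_pos
    show "h \<in> gball 0 ((\<rho> + R) / 2)" "0 < t h" "t h \<le> 3 / 2 * t g" by (auto simp: gball_def t_def field_simps)
  qed
  have one: "1 \<le> K * (\<Sum>h\<in>gball g (\<eta> * t g). 1 / t h ^ D)" if g: "g \<in> N" for g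
  proof -
    have gR: "g \<in> gball 0 R" using N that by (auto simp: disjoint_balls_def)
    have "4 \<le> \<eta> * t g" using gap t_lower[OF gR] \<eta> by (smt (verit) mult_left_mono)
    then have low: "c\<^sub>1 * (\<eta> * t g) ^ D \<le> card (gball g (\<eta> * t g))" using gball_lower by simp
    have tg: "t g > 0" using t_lower[OF gR] gap_pos by simp
    have "1 = K * (c\<^sub>1 * (\<eta> * t g) ^ D / (3 / 2 * t g) ^ D)"
      unfolding K_def using c\<^sub>1 \<eta> tg by (simp add: power_mult_distrib power_divide field_simps)
    also have "\<dots> \<le> K * (card (gball g (\<eta> * t g)) / (3 / 2 * t g) ^ D)"
      using low K tg by (intro mult_left_mono divide_right_mono) auto
    also have "card (gball g (\<eta> * t g)) / (3 / 2 * t g) ^ D = (\<Sum>h\<in>gball g (\<eta> * t g). 1 / (3 / 2 * t g) ^ D)"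
      by simp
    also have "K * \<dots> \<le> K * (\<Sum>h\<in>gball g (\<eta> * t g). 1 / t h ^ D)"
      using ball[OF g] K by (intro mult_left_mono sum_mono divide_left_mono power_mono mult_pos_pos zero_less_power)
        (auto intro: less_imp_le simp: tg)
    finally show ?thesis .
  qed
  have "real (card N) = (\<Sum>g\<in>N. 1)" by simp
  also have "\<dots> \<le> (\<Sum>g\<in>N. K * (\<Sum>h\<in>gball g (\<eta> * t g). 1 / t h ^ D))" by (intro sum_mono one)
  also have "\<dots> = K * (\<Sum>h\<in>(\<Union>g\<in>N. gball g (\<eta> * t g)). 1 / t h ^ D)"
    using N disjoint_balls_finite[OF N]
    by (subst sum.UNION_disjoint) (auto simp: disjoint_balls_def sum_distrib_left)
  also have "\<dots> \<le> K * (\<Sum>h\<in>gball 0 ((\<rho> + R) / 2). 1 / t h ^ D)"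
  proof (intro mult_left_mono sum_mono2 K)
    fix h assume "h \<in> gball 0 ((\<rho> + R) / 2) - (\<Union>g\<in>N. gball g (\<eta> * t g))"
    then have "t h \<ge> 0" using gap_pos by (auto simp: t_def gball_def)
    then show "0 \<le> 1 / t h ^ D" by simp
  qed (use ball in auto)
  finally show ?thesis by (simp add: K_def)
qed

text \<open>All balls whose dilates contain \<open>h\<close> have radii comparable to s = \<eta>
  t(h). Their concentric balls of radius s / 2 are disjoint and lie within 30 s + s / 2 \<le> 31 s
  of \<open>h\<close>, so volumes can be compared; 62 is the ratio of the radii.\<close>

lemma overlap:
  assumes N: "disjoint_balls N"
  shows "card {g \<in> N. h \<in> gball g (15 * \<eta> * t g)} \<le> c\<^sub>2 * 62 ^ D / c\<^sub>1"
proof -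
  define N' where "N' = {g \<in> N. h \<in> gball g (15 * \<eta> * t g)}"
  define s where "s = \<eta> * t h"
  have fin: "finite N'" unfolding N'_def using disjoint_balls_finite[OF N] by simp
  show ?thesis
  proof (cases "N' = {}")
    case True
    have "0 \<le> c\<^sub>2 * 62 ^ D / c\<^sub>1" using c\<^sub>1 c\<^sub>2 by simp
    with True show ?thesis unfolding N'_def by (metis card.empty of_nat_0)
  next
    case False
    have comp: "t g \<le> 2 * t h" "t h \<le> 3 / 2 * t g" "0 < t g" "4 \<le> \<eta> * t g" if "g \<in> N'" for g
    proof -
      have g: "g \<in> gball 0 R" using N that by (auto simp: disjoint_balls_def N'_def)
      show "t g \<le> 2 * t h" "t h \<le> 3 / 2 * t g" using t_comparable[OF g, of h] that by (auto simp: N'_def)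
      show "0 < t g" using t_lower[OF g] gap_pos by simp
      show "4 \<le> \<eta> * t g" using gap t_lower[OF g] \<eta> by (smt (verit) mult_left_mono)
    qed
    obtain g\<^sub>0 where "g\<^sub>0 \<in> N'" using False by auto
    \<comment> \<open>The 4 in the gap condition is needed here: one factor 2 is lost in comparing
      t(g) with t(h), another in halving s, and the radius s / 2 must still be at least 1 for the
      volume bound.\<close>
    then have "4 \<le> \<eta> * (2 * t h)" using comp[of g\<^sub>0] mult_left_mono[of "t g\<^sub>0" "2 * t h" \<eta>] \<eta> by linarith
    then have s: "s / 2 \<ge> 1" by (simp add: s_def)
    have small: "gball g (s / 2) \<subseteq> gball g (\<eta> * t g)" if "g \<in> N'" for g
    proof -
      have "\<eta> * t h \<le> \<eta> * (2 * t g)" using comp[OF that] \<eta> by (intro mult_left_mono) auto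
      then have "s / 2 \<le> \<eta> * t g" by (simp add: s_def)
      then show ?thesis by (auto simp: gball_def)
    qed
    have big: "gball g (s / 2) \<subseteq> gball h (31 * s)" if "g \<in> N'" for g
    proof
      fix k assume k: "k \<in> gball g (s / 2)"
      have "\<eta> * t g \<le> \<eta> * (2 * t h)" using comp[OF that] \<eta> by (intro mult_left_mono) auto
      moreover have "real (len (- g + h)) \<le> 15 * \<eta> * t g" using that by (auto simp: N'_def gball_def)
      moreover have "real (len (- h + k)) \<le> real (len (- g + h)) + real (len (- g + k))"
        using len_triangle[of h k g] len_commute[of h g] by linarith
      moreover have "real (len (- g + k)) \<le> s / 2" using k by (simp add: gball_def)
      ultimately show "k \<in> gball h (31 * s)" using s by (simp add: gball_def s_def)
    qed
    have "c\<^sub>1 * (s / 2) ^ D * card N' = (\<Sum>g\<in>N'. c\<^sub>1 * (s / 2) ^ D)" by simp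
    also have "\<dots> \<le> (\<Sum>g\<in>N'. real (card (gball g (s / 2))))" using gball_lower s by (intro sum_mono) auto
    also have "\<dots> = card (\<Union>g\<in>N'. gball g (s / 2))"
    proof (subst card_UN_disjoint[OF fin])
      show "\<forall>i\<in>N'. \<forall>j\<in>N'. i \<noteq> j \<longrightarrow> gball i (s / 2) \<inter> gball j (s / 2) = {}"
        using small N unfolding disjoint_balls_def N'_def by blast
    qed auto
    also have "card (\<Union>g\<in>N'. gball g (s / 2)) \<le> card (gball h (31 * s))"
      using big by (intro card_mono) auto
    also have "card (gball h (31 * s)) \<le> c\<^sub>2 * (31 * s) ^ D" by (rule gball_upper) (use s in simp)
    finally have "c\<^sub>1 * (s / 2) ^ D * card N' \<le> c\<^sub>2 * (31 * s) ^ D" by simp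
    also have "c\<^sub>2 * (31 * s) ^ D = c\<^sub>1 * (s / 2) ^ D * (c\<^sub>2 * 62 ^ D / c\<^sub>1)"
    proof -
      have "(31 * s) ^ D = (s / 2) ^ D * 62 ^ D" unfolding power_mult_distrib[symmetric] by simp
      then show ?thesis using c\<^sub>1 by simp
    qed
    finally show ?thesis using c\<^sub>1 s unfolding N'_def by (subst (asm) mult_le_cancel_left_pos) auto
  qed
qed

end

section \<open>Control of harmonic functions by finitely many averages\<close>

context rough_graph
begin

lemma mem_pull_zero: "x \<in> pull 0 r \<longleftrightarrow> real (len (\<phi> x)) \<le> r"
  by (simp add: mem_pull)

text \<open>The cutoff is the positive part of the distance to the sphere of radius \<rho>, which
  changes by at most \<open>L\<close> along an edge. Keeping it as a weight, instead of bounding it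
  below on a smaller ball, gives an estimate for all scales of the Whitney covering at once.\<close>

lemma caccioppoli_pull:
  fixes \<rho> :: real
  assumes harm: "\<And>x. laplacian E u x = 0"
  shows "(\<Sum>x\<in>pull 0 \<rho>. (\<rho> - real (len (\<phi> x)))\<^sup>2 * energy E u x)
     \<le> 4 * \<Delta> * (real L)\<^sup>2 * (\<Sum>x\<in>pull 0 (\<rho> + real L). (u x)\<^sup>2)"
proof -
  define \<theta> where "\<theta> x = max 0 (\<rho> - real (len (\<phi> x)))" for x
  define F where "F = pull 0 (\<rho> + real L)"
  have len_nbr: "\<bar>real (len (\<phi> y)) - real (len (\<phi> x))\<bar> \<le> L" if "E x y" for x y
    using len_lipschitz[of "\<phi> x" "\<phi> y"] stretch[OF that] by linarith
  have "(\<Sum>x\<in>pull 0 \<rho>. (\<rho> - real (len (\<phi> x)))\<^sup>2 * energy E u x) = (\<Sum>x\<in>F. (\<theta> x)\<^sup>2 * energy E u x)"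
    unfolding F_def by (intro sum.mono_neutral_cong_left) (auto simp: mem_pull_zero \<theta>_def)
  also have "\<dots> \<le> 4 * (\<Sum>x\<in>F. (\<Sum>y\<in>{y \<in> F. E x y}. (\<theta> y - \<theta> x)\<^sup>2) * (u x)\<^sup>2)"
  proof (rule caccioppoli[OF E_sym _ _ harm])
    fix x assume "\<theta> x \<noteq> 0"
    then have "real (len (\<phi> x)) \<le> \<rho>" by (auto simp: \<theta>_def max_def split: if_splits)
    then show "x \<in> F \<and> {y. E x y} \<subseteq> F" using len_nbr by (fastforce simp: F_def mem_pull_zero)
  qed (simp_all add: F_def)
  also have "\<dots> \<le> 4 * (\<Sum>x\<in>F. (\<Delta> * (real L)\<^sup>2) * (u x)\<^sup>2)"
  proof (intro mult_left_mono sum_mono mult_right_mono)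
    fix x
    have "(\<Sum>y\<in>{y \<in> F. E x y}. (\<theta> y - \<theta> x)\<^sup>2) \<le> (\<Sum>y\<in>{y \<in> F. E x y}. (real L)\<^sup>2)"
    proof (intro sum_mono power2_le_iff_abs_le[THEN iffD2])
      fix y assume "y \<in> {y \<in> F. E x y}"
      then show "\<bar>\<theta> y - \<theta> x\<bar> \<le> real L" using len_nbr[of x y] by (auto simp: \<theta>_def max_def)
    qed auto
    also have "\<dots> = card {y \<in> F. E x y} * (real L)\<^sup>2" by simp
    also have "card {y \<in> F. E x y} \<le> \<Delta>"
      using card_mono[OF finite_nbrs, of "{y \<in> F. E x y}" x] degree[of x] by fastforce
    then have "card {y \<in> F. E x y} * (real L)\<^sup>2 \<le> \<Delta> * (real L)\<^sup>2"
      by (intro mult_right_mono) auto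
    finally show "(\<Sum>y\<in>{y \<in> F. E x y}. (\<theta> y - \<theta> x)\<^sup>2) \<le> \<Delta> * (real L)\<^sup>2" .
  qed auto
  finally show ?thesis by (simp add: F_def mult.assoc flip: sum_distrib_left)
qed

text \<open>The sets are chosen before \<open>u\<close>: the averages over them are one finite list
  of linear functionals that serves all harmonic functions simultaneously, which the dimension count
  requires.\<close>

definition whitney_bound :: "real \<Rightarrow> real \<Rightarrow> real \<Rightarrow> real \<Rightarrow> bool" where
  "whitney_bound \<delta> C \<rho> R \<longleftrightarrow>
     (\<exists>(N :: 'g set) Q. finite N \<and> (\<forall>g\<in>N. Q g \<noteq> {} \<and> Q g \<subseteq> pull 0 (\<rho> + real L)) \<and>
        card N \<le> C * (\<Sum>h\<in>gball 0 ((\<rho> + R) / 2). 1 / (\<rho> - real (len h)) ^ D) \<and>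
        (\<forall>u. (\<forall>x. laplacian E u x = 0) \<longrightarrow> (\<Sum>x\<in>pull 0 R. (u x)\<^sup>2)
           \<le> \<delta> * (\<Sum>x\<in>pull 0 (\<rho> + real L). (u x)\<^sup>2) + (\<Sum>g\<in>N. (\<Sum>x\<in>Q g. u x)\<^sup>2 / card (Q g))))"

lemma whitney_estimate:
  assumes \<delta>: "\<delta> > 0"
  shows "\<exists>C>0. \<exists>T\<^sub>0. \<forall>\<rho> R. \<rho> - R \<ge> T\<^sub>0 \<longrightarrow> whitney_bound \<delta> C \<rho> R"
proof -
  obtain P r\<^sub>0 :: real where P: "P > 0" and poinc: "\<And>r g u. r \<ge> r\<^sub>0 \<Longrightarrow> pull g r \<noteq> {} \<and> (\<Sum>x\<in>pull g r. (u x)\<^sup>2)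
      \<le> P * r\<^sup>2 * (\<Sum>w\<in>pull g (5 * r). energy E u w) + (\<Sum>x\<in>pull g r. u x)\<^sup>2 / card (pull g r)"
    using poincare by blast
  define O' where "O' = c\<^sub>2 * 62 ^ D / c\<^sub>1"
  have O': "O' > 0" unfolding O'_def using c\<^sub>1 c\<^sub>2 by simp
  \<comment> \<open>Here 36 = 9 * 4: the 9 is from the radius 3 \<eta> t(g), the 4 from t(g) \<le> 2
    t on the dilated ball. The remaining factors come from the overlap and from Caccioppoli; the
    summand 1 makes \<open>C\<close> positive.\<close>
  define C where "C = P * 36 * (O' * (4 * \<Delta> * (real L)\<^sup>2)) + 1"
  have C: "C > 0" unfolding C_def using P O' by (auto intro!: add_nonneg_pos mult_nonneg_nonneg)
  define \<eta> where "\<eta> = min (1 / 30) (sqrt (\<delta> / C))"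
  have \<eta>: "0 < \<eta>" "\<eta> \<le> 1 / 30" unfolding \<eta>_def using \<delta> C by auto
  have "\<eta>\<^sup>2 \<le> (sqrt (\<delta> / C))\<^sup>2" by (rule power_mono) (use \<eta> in \<open>auto simp: \<eta>_def\<close>)
  then have C\<eta>: "C * \<eta>\<^sup>2 \<le> \<delta>" using \<delta> C by (simp add: field_simps)
  \<comment> \<open>The threshold for the gap yields \<eta> t(g) \<ge> 4 + |r0|, which serves both
    the Whitney covering and the least radius r0 of the Poincare inequality.\<close>
  have "whitney_bound \<delta> ((3/2) ^ D / (c\<^sub>1 * \<eta> ^ D)) \<rho> R"
    if gap: "\<rho> - R \<ge> (4 + \<bar>r\<^sub>0\<bar>) / \<eta>" for \<rho> R :: real
  proof -
    have gap': "\<eta> * (\<rho> - R) \<ge> 4 + \<bar>r\<^sub>0\<bar>" using gap \<eta> by (simp add: field_simps)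
    interpret whitney S D c\<^sub>1 c\<^sub>2 \<rho> R \<eta>
      using \<eta> gap' by unfold_locales auto
    obtain N where N: "disjoint_balls N" "\<And>h. h \<in> gball 0 R \<Longrightarrow> \<exists>g\<in>N. h \<in> gball g (3 * \<eta> * t g)"
      using ex_maximal_disjoint_balls by blast
    have fin: "finite N" using disjoint_balls_finite N by blast
    define Q where "Q g = pull g (3 * \<eta> * t g)" for g
    have NR: "g \<in> gball 0 R" if "g \<in> N" for g using N(1) that by (auto simp: disjoint_balls_def)
    have tg: "t g > 0" "3 * \<eta> * t g \<ge> r\<^sub>0" if "g \<in> N" for g
    proof -
      show "t g > 0" using t_lower[OF NR[OF that]] gap_pos by simp
      have "\<eta> * (\<rho> - R) \<le> \<eta> * t g" using t_lower[OF NR[OF that]] \<eta> by (intro mult_left_mono) auto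
      then show "3 * \<eta> * t g \<ge> r\<^sub>0" using gap' by linarith
    qed
    have in_\<rho>: "pull g (15 * \<eta> * t g) \<subseteq> pull 0 \<rho>" if "g \<in> N" for g
    proof
      fix w assume w: "w \<in> pull g (15 * \<eta> * t g)"
      then have "t g \<le> 2 * t (\<phi> w)" by (intro t_comparable NR that) (simp add: pull_def)
      then show "w \<in> pull 0 \<rho>" using tg[OF that] by (simp add: mem_pull_zero t_def)
    qed
    have Q: "Q g \<noteq> {}" "Q g \<subseteq> pull 0 (\<rho> + real L)" if "g \<in> N" for g
    proof -
      show "Q g \<noteq> {}" unfolding Q_def using poinc tg[OF that] by blast
      have "3 * \<eta> * t g \<le> 15 * \<eta> * t g" using \<eta> tg[OF that] by (intro mult_right_mono) auto
      then have "Q g \<subseteq> pull g (15 * \<eta> * t g)" unfolding Q_def by (auto simp: mem_pull)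
      moreover have "pull 0 \<rho> \<subseteq> pull 0 (\<rho> + real L)" by (auto simp: mem_pull_zero)
      ultimately show "Q g \<subseteq> pull 0 (\<rho> + real L)" using in_\<rho>[OF that] by blast
    qed
    have est: "(\<Sum>x\<in>pull 0 R. (u x)\<^sup>2)
           \<le> \<delta> * (\<Sum>x\<in>pull 0 (\<rho> + real L). (u x)\<^sup>2) + (\<Sum>g\<in>N. (\<Sum>x\<in>Q g. u x)\<^sup>2 / card (Q g))"
      if harm: "\<forall>x. laplacian E u x = 0" for u
    proof -
      define e where "e w = (t (\<phi> w))\<^sup>2 * energy E u w" for w
      have e: "e w \<ge> 0" for w unfolding e_def by simp
      have ball: "(\<Sum>x\<in>Q g. (u x)\<^sup>2) \<le> P * 36 * \<eta>\<^sup>2 * (\<Sum>w\<in>pull g (15 * \<eta> * t g). e w) + (\<Sum>x\<in>Q g. u x)\<^sup>2 / card (Q g)"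
        if g: "g \<in> N" for g
      proof -
        have "(\<Sum>x\<in>Q g. (u x)\<^sup>2) \<le> P * (3 * \<eta> * t g)\<^sup>2 * (\<Sum>w\<in>pull g (15 * \<eta> * t g). energy E u w) + (\<Sum>x\<in>Q g. u x)\<^sup>2 / card (Q g)"
          using poinc[of "3 * \<eta> * t g" g u] tg[OF g] by (simp add: Q_def mult.assoc)
        \<comment> \<open>The factor t(g)^2 from the squared radius is moved inside the sum, where
          it becomes the weight of the Caccioppoli inequality.\<close>
        moreover have "(t g)\<^sup>2 * (\<Sum>w\<in>pull g (15 * \<eta> * t g). energy E u w) \<le> 4 * (\<Sum>w\<in>pull g (15 * \<eta> * t g). e w)"
          unfolding sum_distrib_left e_def
        proof (rule sum_mono)
          fix w assume w: "w \<in> pull g (15 * \<eta> * t g)"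
          then have "t g \<le> 2 * t (\<phi> w)" by (intro t_comparable NR g) (simp add: pull_def)
          then have "(t g)\<^sup>2 \<le> (2 * t (\<phi> w))\<^sup>2" using tg[OF g] by (intro power_mono) auto
          from mult_right_mono[OF this, of "energy E u w"]
          show "(t g)\<^sup>2 * energy E u w \<le> 4 * ((t (\<phi> w))\<^sup>2 * energy E u w)"
            by (simp add: power_mult_distrib mult.assoc)
        qed
        from mult_left_mono[OF this, of "P * 9 * \<eta>\<^sup>2"]
        have "P * (3 * \<eta> * t g)\<^sup>2 * (\<Sum>w\<in>pull g (15 * \<eta> * t g). energy E u w) \<le> P * 36 * \<eta>\<^sup>2 * (\<Sum>w\<in>pull g (15 * \<eta> * t g). e w)"
          using P by (simp add: power_mult_distrib mult_ac)
        ultimately show ?thesis by linarith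
      qed
      have "(\<Sum>x\<in>pull 0 R. (u x)\<^sup>2) \<le> (\<Sum>x\<in>pull 0 R. \<Sum>g\<in>N. if x \<in> Q g then (u x)\<^sup>2 else 0)"
      proof (rule sum_mono)
        fix x assume "x \<in> pull 0 R"
        then obtain g where g: "g \<in> N" "x \<in> Q g" using N(2)[of "\<phi> x"] by (auto simp: pull_def Q_def)
        have "(if x \<in> Q g then (u x)\<^sup>2 else 0) \<le> (\<Sum>g\<in>N. if x \<in> Q g then (u x)\<^sup>2 else 0)"
          using fin g by (intro member_le_sum) auto
        then show "(u x)\<^sup>2 \<le> (\<Sum>g\<in>N. if x \<in> Q g then (u x)\<^sup>2 else 0)" using g by simp
      qed
      also have "\<dots> = (\<Sum>g\<in>N. \<Sum>x\<in>pull 0 R. if x \<in> Q g then (u x)\<^sup>2 else 0)" by (rule sum.swap)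
      also have "\<dots> \<le> (\<Sum>g\<in>N. \<Sum>x\<in>Q g. (u x)\<^sup>2)"
        by (intro sum_mono) (auto simp: Q_def simp flip: sum.inter_filter intro!: sum_mono2)
      also have "\<dots> \<le> (\<Sum>g\<in>N. P * 36 * \<eta>\<^sup>2 * (\<Sum>w\<in>pull g (15 * \<eta> * t g). e w) + (\<Sum>x\<in>Q g. u x)\<^sup>2 / card (Q g))"
        by (intro sum_mono ball)
      also have "\<dots> = P * 36 * \<eta>\<^sup>2 * (\<Sum>g\<in>N. \<Sum>w\<in>pull g (15 * \<eta> * t g). e w) + (\<Sum>g\<in>N. (\<Sum>x\<in>Q g. u x)\<^sup>2 / card (Q g))"
        by (simp add: sum.distrib sum_distrib_left)
      finally have 1: "(\<Sum>x\<in>pull 0 R. (u x)\<^sup>2) \<le> \<dots>" .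
      have "(\<Sum>g\<in>N. \<Sum>w\<in>pull g (15 * \<eta> * t g). e w) = (\<Sum>g\<in>N. \<Sum>w\<in>pull 0 \<rho>. if w \<in> pull g (15 * \<eta> * t g) then e w else 0)"
        by (intro sum.cong refl sum.mono_neutral_cong_left) (use in_\<rho> in auto)
      also have "\<dots> = (\<Sum>w\<in>pull 0 \<rho>. \<Sum>g\<in>N. if w \<in> pull g (15 * \<eta> * t g) then e w else 0)" by (rule sum.swap)
      also have "\<dots> = (\<Sum>w\<in>pull 0 \<rho>. card {g \<in> N. \<phi> w \<in> gball g (15 * \<eta> * t g)} * e w)"
        using fin by (intro sum.cong refl) (simp add: pull_def flip: sum.inter_filter)
      also have "\<dots> \<le> (\<Sum>w\<in>pull 0 \<rho>. O' * e w)"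
        unfolding O'_def using e by (intro sum_mono mult_right_mono overlap N)
      also have "\<dots> = O' * (\<Sum>w\<in>pull 0 \<rho>. (\<rho> - real (len (\<phi> w)))\<^sup>2 * energy E u w)"
        by (simp add: e_def t_def sum_distrib_left)
      also have "\<dots> \<le> O' * (4 * \<Delta> * (real L)\<^sup>2 * (\<Sum>x\<in>pull 0 (\<rho> + real L). (u x)\<^sup>2))"
        using harm O' by (intro mult_left_mono caccioppoli_pull) auto
      finally have 2: "P * 36 * \<eta>\<^sup>2 * (\<Sum>g\<in>N. \<Sum>w\<in>pull g (15 * \<eta> * t g). e w)
          \<le> P * 36 * \<eta>\<^sup>2 * (O' * (4 * \<Delta> * (real L)\<^sup>2 * (\<Sum>x\<in>pull 0 (\<rho> + real L). (u x)\<^sup>2)))"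
        using P by (intro mult_left_mono) auto
      also have "\<dots> = (C - 1) * (\<eta>\<^sup>2 * (\<Sum>x\<in>pull 0 (\<rho> + real L). (u x)\<^sup>2))"
        unfolding C_def by simp
      also have "\<dots> \<le> C * (\<eta>\<^sup>2 * (\<Sum>x\<in>pull 0 (\<rho> + real L). (u x)\<^sup>2))"
        by (intro mult_right_mono mult_nonneg_nonneg sum_nonneg) auto
      also have "\<dots> \<le> \<delta> * (\<Sum>x\<in>pull 0 (\<rho> + real L). (u x)\<^sup>2)"
        using C\<eta> by (subst mult.assoc[symmetric], intro mult_right_mono sum_nonneg) auto
      finally show ?thesis using 1 by linarith
    qed
    show ?thesis
      using fin Q est card_disjoint_balls[OF N(1)] unfolding t_def whitney_bound_def
      by (intro exI[of _ N] exI[of _ Q]) auto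
  qed
  then show ?thesis
    using c\<^sub>1 \<eta> by (intro exI[of _ "(3/2) ^ D / (c\<^sub>1 * \<eta> ^ D)"] exI[of _ "(4 + \<bar>r\<^sub>0\<bar>) / \<eta>"]) auto
qed

end

subsection \<open>Gram-Schmidt residuals on finite vertex sets\<close>

definition dot :: "'a set \<Rightarrow> ('a \<Rightarrow> real) \<Rightarrow> ('a \<Rightarrow> real) \<Rightarrow> real" where
  "dot F u v = (\<Sum>x\<in>F. u x * v x)"

lemma dot_commute: "dot F u v = dot F v u"
  by (simp add: dot_def mult.commute)

lemma dot_add_left: "dot F (\<lambda>x. u x + v x) w = dot F u w + dot F v w"
  by (simp add: dot_def distrib_right sum.distrib)

lemma dot_diff_left: "dot F (\<lambda>x. u x - v x) w = dot F u w - dot F v w"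
  by (simp add: dot_def left_diff_distrib sum_subtractf)

lemma dot_scale_left: "dot F (\<lambda>x. a * u x) w = a * dot F u w"
  by (simp add: dot_def sum_distrib_left mult.assoc)

lemma dot_sum_left: "dot F (\<lambda>x. \<Sum>j\<in>J. a j * f j x) w = (\<Sum>j\<in>J. a j * dot F (f j) w)"
  unfolding dot_def by (simp add: sum_distrib_left sum_distrib_right mult.assoc) (rule sum.swap)

lemma dot_add_right: "dot F w (\<lambda>x. u x + v x) = dot F w u + dot F w v"
  by (simp add: dot_def distrib_left sum.distrib)

lemma dot_diff_right: "dot F w (\<lambda>x. u x - v x) = dot F w u - dot F w v"
  by (simp add: dot_def right_diff_distrib sum_subtractf)

lemma dot_sum_right: "dot F w (\<lambda>x. \<Sum>j\<in>J. a j * f j x) = (\<Sum>j\<in>J. a j * dot F w (f j))"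
  using dot_sum_left[of F a f J w] by (simp add: dot_commute)

lemma dot_self: "dot F u u = (\<Sum>x\<in>F. (u x)\<^sup>2)"
  by (simp add: dot_def power2_eq_square)

lemma dot_self_nonneg [simp]: "0 \<le> dot F u u"
  unfolding dot_self by (intro sum_nonneg) auto

lemma dot_self_mono: "finite F' \<Longrightarrow> F \<subseteq> F' \<Longrightarrow> dot F u u \<le> dot F' u u"
  unfolding dot_self by (intro sum_mono2) auto

lemma dot_self_zero:
  assumes "finite F" "dot F u u = 0" "x \<in> F"
  shows "u x = 0"
proof -
  have "\<forall>x\<in>F. (u x)\<^sup>2 = 0"
    using assms unfolding dot_self by (subst (asm) sum_nonneg_eq_0_iff) auto
  then show ?thesis using assms(3) by simp
qed

text \<open>One step of Gram-Schmidt. The induction hypothesis is used for \<open>u\<close> and for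
  \<open>f k\<close>, after which one component along the new direction \<open>w\<close> is
  removed.\<close>

lemma ex_projection:
  fixes k :: nat
  assumes "finite F"
  shows "\<exists>c. \<forall>j<k. dot F (\<lambda>x. u x - (\<Sum>l<k. c l * f l x)) (f j) = 0"
proof (induction k arbitrary: u)
  case 0
  then show ?case by simp
next
  case (Suc k)
  obtain a where a: "\<forall>j<k. dot F (\<lambda>x. u x - (\<Sum>l<k. a l * f l x)) (f j) = 0" using Suc by blast
  obtain b where b: "\<forall>j<k. dot F (\<lambda>x. f k x - (\<Sum>l<k. b l * f l x)) (f j) = 0" using Suc by blast
  define v where "v = (\<lambda>x. u x - (\<Sum>l<k. a l * f l x))"
  define w where "w = (\<lambda>x. f k x - (\<Sum>l<k. b l * f l x))"
  \<comment> \<open>The form may be degenerate. If \<open>w\<close> vanishes on \<open>F\<close>,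
    then s = 0 by the convention for division by zero, and \<open>dot F v w\<close> is already
    0.\<close>
  define s where "s = dot F v w / dot F w w"
  define c where "c l = (if l = k then s else a l - s * b l)" for l
  have eq: "(\<lambda>x. u x - (\<Sum>l<Suc k. c l * f l x)) = (\<lambda>x. v x - s * w x)"
  proof
    fix x
    have "(\<Sum>l<k. c l * f l x) = (\<Sum>l<k. a l * f l x) - s * (\<Sum>l<k. b l * f l x)"
      unfolding c_def by (simp add: left_diff_distrib sum_subtractf sum_distrib_left mult.assoc)
    then show "u x - (\<Sum>l<Suc k. c l * f l x) = v x - s * w x"
      by (simp add: v_def w_def c_def algebra_simps)
  qed
  have old: "dot F (\<lambda>x. v x - s * w x) (f j) = 0" if "j < k" for j
    using a b that by (simp add: dot_diff_left dot_scale_left v_def w_def)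
  have vw: "dot F v w - s * dot F w w = 0"
  proof (cases "dot F w w = 0")
    case True
    then have "dot F v w = 0" unfolding dot_def using dot_self_zero[OF assms True] by simp
    then show ?thesis using True by simp
  qed (simp add: s_def)
  have "dot F (\<lambda>x. v x - s * w x) (f k)
      = dot F (\<lambda>x. v x - s * w x) w + dot F (\<lambda>x. v x - s * w x) (\<lambda>x. \<Sum>l<k. b l * f l x)"
    unfolding dot_def by (simp add: w_def flip: sum.distrib distrib_left)
  also have "dot F (\<lambda>x. v x - s * w x) (\<lambda>x. \<Sum>l<k. b l * f l x) = 0"
    using old by (simp add: dot_sum_right)
  also have "dot F (\<lambda>x. v x - s * w x) w = 0"
    using vw by (simp add: dot_diff_left dot_scale_left)
  finally have "dot F (\<lambda>x. v x - s * w x) (f k) = 0" by simp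
  then show ?case using old by (intro exI[of _ c]) (auto simp: eq less_Suc_eq simp del: sum.lessThan_Suc)
qed

text \<open>Orthogonality is required on \<open>F\<close> only, but the residual is a combination of
  the given functions on the whole graph. Residuals of harmonic functions are therefore
  harmonic.\<close>

definition residual :: "'a set \<Rightarrow> (nat \<Rightarrow> 'a \<Rightarrow> real) \<Rightarrow> nat \<Rightarrow> 'a \<Rightarrow> real" where
  "residual F f i = (SOME w. (\<exists>c. w = (\<lambda>x. f i x - (\<Sum>j<i. c j * f j x))) \<and> (\<forall>j<i. dot F w (f j) = 0))"

text \<open>The squared distance on \<open>F\<close> from \<open>f i\<close> to the span of its
  predecessors. The product of the heights is the Gram determinant of the family with respect to
  \<open>dot F\<close>, so sums of \<open>ln (height F f i)\<close> are its logarithm.\<close>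

definition height :: "'a set \<Rightarrow> (nat \<Rightarrow> 'a \<Rightarrow> real) \<Rightarrow> nat \<Rightarrow> real" where
  "height F f i = dot F (residual F f i) (residual F f i)"

lemma residual:
  assumes "finite F"
  shows "\<exists>c. residual F f i = (\<lambda>x. f i x - (\<Sum>j<i. c j * f j x))"
    and "j < i \<Longrightarrow> dot F (residual F f i) (f j) = 0"
proof -
  have "(\<exists>c. residual F f i = (\<lambda>x. f i x - (\<Sum>j<i. c j * f j x))) \<and> (\<forall>j<i. dot F (residual F f i) (f j) = 0)"
    (is "?P (residual F f i)")
  proof -
    obtain c where "\<forall>j<i. dot F (\<lambda>x. f i x - (\<Sum>l<i. c l * f l x)) (f j) = 0"
      using ex_projection[OF assms, of i "f i" f] ..
    then have "?P (\<lambda>x. f i x - (\<Sum>l<i. c l * f l x))" by (intro conjI exI[of _ c] refl)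
    then show ?thesis unfolding residual_def by (rule someI[of ?P])
  qed
  then show "\<exists>c. residual F f i = (\<lambda>x. f i x - (\<Sum>j<i. c j * f j x))"
    and "j < i \<Longrightarrow> dot F (residual F f i) (f j) = 0" by auto
qed

lemma residual_orthogonal_span:
  assumes "finite F" "k \<le> i"
  shows "dot F (residual F f i) (\<lambda>x. \<Sum>j<k. c j * f j x) = 0"
  using residual(2)[OF assms(1)] assms(2) by (simp add: dot_sum_right)

lemma residual_orthogonal:
  assumes "finite F" "i \<noteq> j"
  shows "dot F (residual F f i) (residual F f j) = 0"
proof -
  have "dot F (residual F f i) (residual F f j) = 0" if "j < i" for i j
  proof -
    obtain c where c: "residual F f j = (\<lambda>x. f j x - (\<Sum>l<j. c l * f l x))" using residual(1)[OF assms(1)] by blast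
    show ?thesis
      using residual(2)[OF assms(1) that, of f] residual_orthogonal_span[OF assms(1), of j i f c] that
      unfolding c by (simp add: dot_diff_right)
  qed
  then show ?thesis using assms(2) dot_commute by (metis linorder_neqE_nat)
qed

lemma height_le:
  assumes "finite F"
  shows "height F f i \<le> dot F (\<lambda>x. f i x - (\<Sum>j<i. c j * f j x)) (\<lambda>x. f i x - (\<Sum>j<i. c j * f j x))"
proof -
  obtain a where a: "residual F f i = (\<lambda>x. f i x - (\<Sum>j<i. a j * f j x))" using residual(1)[OF assms] by blast
  define z where "z = (\<lambda>x. \<Sum>j<i. (a j - c j) * f j x)"
  have "(\<lambda>x. f i x - (\<Sum>j<i. c j * f j x)) = (\<lambda>x. residual F f i x + z x)"
    unfolding a z_def by (simp add: left_diff_distrib sum_subtractf)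
  moreover have "dot F (residual F f i) z = 0"
    unfolding z_def by (rule residual_orthogonal_span[OF assms]) simp
  ultimately show ?thesis
    using dot_self_nonneg[of F z]
    by (simp add: height_def dot_add_left dot_add_right dot_commute[of F z "residual F f i"])
qed

lemma height_le_self: "finite F \<Longrightarrow> height F f i \<le> dot F (f i) (f i)"
  using height_le[of F f i "\<lambda>_. 0"] by simp

text \<open>The height is a minimum over combinations, and the residual for the larger set is one
  competitor for the smaller set. This allows one orthogonal system, that of the larger set, to be
  used on both.\<close>

lemma height_le_residual:
  assumes "finite F'" "F \<subseteq> F'"
  shows "height F f i \<le> dot F (residual F' f i) (residual F' f i)"
  using residual(1)[OF assms(1), of f i] height_le[OF finite_subset[OF assms(2,1)], of f i] by auto

lemma height_mono:
  assumes "finite F'" "F \<subseteq> F'"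
  shows "height F f i \<le> height F' f i"
  using height_le_residual[OF assms] dot_self_mono[OF assms] unfolding height_def by (rule order_trans)

lemma bessel:
  assumes F: "finite F" and pos: "\<And>i. i < K \<Longrightarrow> 0 < height F f i"
  shows "(\<Sum>i<K. (dot F g (residual F f i))\<^sup>2 / height F f i) \<le> dot F g g"
proof -
  define a where "a i = dot F g (residual F f i) / height F f i" for i
  define p where "p = (\<lambda>x. \<Sum>i<K. a i * residual F f i x)"
  have pw: "dot F p (residual F f i) = dot F g (residual F f i)" if "i < K" for i
  proof -
    have "dot F p (residual F f i) = (\<Sum>j<K. a j * dot F (residual F f j) (residual F f i))"
      unfolding p_def by (rule dot_sum_left)
    also have "\<dots> = (\<Sum>j<K. if j = i then a i * height F f i else 0)"
      using residual_orthogonal[OF F] by (intro sum.cong) (auto simp: height_def)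
    also have "\<dots> = dot F g (residual F f i)" using that pos[OF that] by (simp add: a_def)
    finally show ?thesis .
  qed
  have pg: "dot F p g = (\<Sum>i<K. (dot F g (residual F f i))\<^sup>2 / height F f i)"
    unfolding dot_commute[of F p g] unfolding p_def dot_sum_right a_def by (simp add: power2_eq_square)
  have "dot F p p = (\<Sum>i<K. a i * dot F (residual F f i) p)"
    by (subst p_def, subst dot_sum_left) (rule refl)
  also have "\<dots> = (\<Sum>i<K. a i * dot F (residual F f i) g)"
    using pw by (intro sum.cong refl) (metis dot_commute lessThan_iff)
  also have "\<dots> = dot F p g" unfolding p_def dot_sum_left ..
  finally have "dot F p p = dot F p g" .
  then have "dot F (\<lambda>x. g x - p x) (\<lambda>x. g x - p x) = dot F g g - dot F p g"
    by (simp add: dot_diff_left dot_diff_right dot_commute[of F g p])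
  then show ?thesis using dot_self_nonneg[of F "\<lambda>x. g x - p x"] pg by simp
qed

text \<open>Jensen's inequality for the exponential, by way of its tangent line at - c: a bound on
  the growth of the logarithm of a determinant becomes a lower bound for a sum of ratios, hence for
  a trace.\<close>

lemma sum_ratio_ge:
  fixes a b :: "nat \<Rightarrow> real"
  assumes "\<And>i. i < K \<Longrightarrow> a i > 0" "\<And>i. i < K \<Longrightarrow> b i > 0"
    and "(\<Sum>i<K. ln (b i) - ln (a i)) \<le> c * K"
  shows "K * exp (- c) \<le> (\<Sum>i<K. a i / b i)"
proof -
  have "exp (- c) * (1 + c - (ln (b i) - ln (a i))) \<le> a i / b i" if "i < K" for i
  proof -
    have "1 + (c - (ln (b i) - ln (a i))) \<le> exp (c - (ln (b i) - ln (a i)))" by (rule exp_ge_add_one_self)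
    then have "exp (- c) * (1 + c - (ln (b i) - ln (a i))) \<le> exp (- c) * exp (c - (ln (b i) - ln (a i)))"
      by (intro mult_left_mono; linarith?) simp
    also have "\<dots> = exp (ln (a i) - ln (b i))" by (simp flip: exp_add)
    also have "\<dots> = a i / b i" using assms that by (simp add: exp_diff)
    finally show ?thesis .
  qed
  then have "(\<Sum>i<K. exp (- c) * (1 + c - (ln (b i) - ln (a i)))) \<le> (\<Sum>i<K. a i / b i)"
    by (intro sum_mono) auto
  moreover have "(\<Sum>i<K. exp (- c) * (1 + c - (ln (b i) - ln (a i))))
      = exp (- c) * (K + c * K - (\<Sum>i<K. ln (b i) - ln (a i)))"
    unfolding sum_distrib_left[symmetric] by (simp add: sum_subtractf sum.distrib algebra_simps)
  moreover have "exp (- c) * K \<le> exp (- c) * (K + c * K - (\<Sum>i<K. ln (b i) - ln (a i)))"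
    using assms(3) by (intro mult_left_mono) auto
  ultimately show ?thesis by (subst mult.commute) linarith
qed

text \<open>The squared averages over the sets \<open>Q g\<close> are summed with Bessel's inequality, so each
  of them costs at most one dimension.\<close>
lemma dimension_le_sampling:
  fixes \<delta> s :: real
  assumes B: "finite B" "A \<subseteq> B" and pos: "\<And>i. i < K \<Longrightarrow> 0 < height A f i"
    and N: "finite N" "\<And>g. g \<in> N \<Longrightarrow> Q g \<noteq> {} \<and> Q g \<subseteq> B"
    and est: "\<And>c i. i < K \<Longrightarrow> (let u = (\<lambda>x. f i x - (\<Sum>j<i. c j * f j x)) in (\<Sum>x\<in>A. (u x)\<^sup>2)
           \<le> \<delta> * (\<Sum>x\<in>B. (u x)\<^sup>2) + (\<Sum>g\<in>N. (\<Sum>x\<in>Q g. u x)\<^sup>2 / card (Q g)))"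
    and slow: "(\<Sum>i<K. ln (height B f i) - ln (height A f i)) \<le> s * K"
  shows "K * exp (- s) \<le> \<delta> * K + card N"
proof -
  define w where "w = residual B f"
  define h where "h = height B f"
  have h: "0 < h i" if "i < K" for i
    using pos[OF that] height_mono[OF B, of f i] by (simp add: h_def)
  have "K * exp (- s) \<le> (\<Sum>i<K. height A f i / h i)"
    using pos h slow unfolding h_def by (intro sum_ratio_ge) auto
  also have "\<dots> \<le> (\<Sum>i<K. \<delta> + (\<Sum>g\<in>N. (dot B (indicator (Q g)) (w i))\<^sup>2 / h i / card (Q g)))"
  proof (rule sum_mono)
    fix i assume i: "i \<in> {..<K}"
    obtain c where c: "w i = (\<lambda>x. f i x - (\<Sum>j<i. c j * f j x))" using residual(1)[OF B(1)] unfolding w_def by blast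
    have ind: "dot B (indicator (Q g)) (w i) = (\<Sum>x\<in>Q g. w i x)" if "g \<in> N" for g
      using N(2)[OF that] B(1) unfolding dot_def
      by (intro sum.mono_neutral_cong_right) (auto simp: indicator_def)
    \<comment> \<open>The numerator is enlarged to the squared norm on \<open>A\<close> of the
      residual taken for \<open>B\<close>; the denominator \<open>h i\<close> is its squared norm on
      \<open>B\<close>.\<close>
    have "height A f i \<le> (\<Sum>x\<in>A. (w i x)\<^sup>2)"
      using height_le_residual[OF B, of f i] by (simp add: dot_self w_def)
    also have "\<dots> \<le> \<delta> * (\<Sum>x\<in>B. (w i x)\<^sup>2) + (\<Sum>g\<in>N. (\<Sum>x\<in>Q g. w i x)\<^sup>2 / card (Q g))"
      using est[of i c] i unfolding c Let_def by simp
    also have "(\<Sum>x\<in>B. (w i x)\<^sup>2) = h i" by (simp add: h_def height_def dot_self w_def)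
    also have "(\<Sum>g\<in>N. (\<Sum>x\<in>Q g. w i x)\<^sup>2 / card (Q g)) = (\<Sum>g\<in>N. (dot B (indicator (Q g)) (w i))\<^sup>2 / card (Q g))"
      using ind by (intro sum.cong) auto
    finally have "height A f i / h i \<le> (\<delta> * h i + (\<Sum>g\<in>N. (dot B (indicator (Q g)) (w i))\<^sup>2 / card (Q g))) / h i"
      using h i by (intro divide_right_mono) (auto intro: less_imp_le)
    also have "\<dots> = \<delta> + (\<Sum>g\<in>N. (dot B (indicator (Q g)) (w i))\<^sup>2 / h i / card (Q g))"
      using h[of i] i by (simp add: add_divide_distrib sum_divide_distrib mult.commute)
    finally show "height A f i / h i \<le> \<delta> + (\<Sum>g\<in>N. (dot B (indicator (Q g)) (w i))\<^sup>2 / h i / card (Q g))" .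
  qed
  also have "\<dots> = \<delta> * K + (\<Sum>g\<in>N. (\<Sum>i<K. (dot B (indicator (Q g)) (w i))\<^sup>2 / h i) / card (Q g))"
    by (simp add: sum.distrib sum_divide_distrib mult.commute) (rule sum.swap)
  also have "\<dots> \<le> \<delta> * K + (\<Sum>g\<in>N. 1)"
  proof (intro add_left_mono sum_mono)
    fix g assume g: "g \<in> N"
    have "(\<Sum>i<K. (dot B (indicator (Q g)) (w i))\<^sup>2 / h i) \<le> dot B (indicator (Q g)) (indicator (Q g))"
      unfolding w_def h_def using B(1) h by (intro bessel) (auto simp: h_def)
    also have "\<dots> = (\<Sum>x\<in>Q g. 1)"
      using N(2)[OF g] B(1) unfolding dot_def
      by (intro sum.mono_neutral_cong_right) (auto simp: indicator_def)
    finally have "(\<Sum>i<K. (dot B (indicator (Q g)) (w i))\<^sup>2 / h i) \<le> card (Q g)" by simp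
    moreover have "card (Q g) > 0" using N(2)[OF g] B(1) by (auto simp: card_gt_0_iff intro: finite_subset)
    ultimately show "(\<Sum>i<K. (dot B (indicator (Q g)) (w i))\<^sup>2 / h i) / card (Q g) \<le> 1" by simp
  qed
  finally show ?thesis by simp
qed

section \<open>Linear independence tested on finite vertex sets\<close>

definition indep_on :: "'a set \<Rightarrow> (nat \<Rightarrow> 'a \<Rightarrow> real) \<Rightarrow> nat \<Rightarrow> bool" where
  "indep_on F f K \<longleftrightarrow> (\<forall>c. (\<forall>x\<in>F. (\<Sum>i<K. c i * f i x) = 0) \<longrightarrow> (\<forall>i<K. c i = 0))"

lemma indep_on_mono: "indep_on F f K \<Longrightarrow> F \<subseteq> F' \<Longrightarrow> indep_on F' f K"
  unfolding indep_on_def by blast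

lemma indep_on_height_pos:
  assumes "indep_on F f K" "finite F" "i < K"
  shows "0 < height F f i"
proof (rule ccontr)
  assume "\<not> 0 < height F f i"
  then have z: "dot F (residual F f i) (residual F f i) = 0"
    using dot_self_nonneg[of F "residual F f i"] by (simp add: height_def)
  obtain c where c: "residual F f i = (\<lambda>x. f i x - (\<Sum>j<i. c j * f j x))" using residual(1)[OF assms(2)] by blast
  define b where "b j = (if j = i then 1 else if j < i then - c j else 0)" for j
  have "(\<Sum>j<K. b j * f j x) = residual F f i x" for x
  proof -
    have "(\<Sum>j<K. b j * f j x) = (\<Sum>j<Suc i. b j * f j x)"
      using assms(3) by (intro sum.mono_neutral_right) (auto simp: b_def)
    also have "\<dots> = residual F f i x"
      by (simp add: b_def c sum_negf)
    finally show ?thesis .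
  qed
  then have "\<forall>x\<in>F. (\<Sum>j<K. b j * f j x) = 0" using dot_self_zero[OF assms(2) z] by simp
  then have "b i = 0" using assms(1,3) unfolding indep_on_def by blast
  then show False by (simp add: b_def)
qed

text \<open>Bessel's inequality for the point masses on \<open>F\<close>: summed over the points it
  gives card F on one side and the number of normalized residuals on the other.\<close>

lemma indep_on_card_le:
  assumes "indep_on F f K" "finite F"
  shows "K \<le> card F"
proof -
  define w where "w = residual F f"
  have h: "0 < height F f i" if "i < K" for i using indep_on_height_pos[OF assms that] .
  have "real K = (\<Sum>i<K. (\<Sum>x\<in>F. (w i x)\<^sup>2) / height F f i)"
  proof -
    have "(\<Sum>i<K. (\<Sum>x\<in>F. (w i x)\<^sup>2) / height F f i) = (\<Sum>i<K. 1)"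
    proof (rule sum.cong[OF refl])
      fix i assume "i \<in> {..<K}"
      then show "(\<Sum>x\<in>F. (w i x)\<^sup>2) / height F f i = 1"
        using h[of i] by (simp add: height_def dot_self w_def)
    qed
    then show ?thesis by simp
  qed
  also have "\<dots> = (\<Sum>x\<in>F. \<Sum>i<K. (dot F (indicator {x}) (w i))\<^sup>2 / height F f i)"
  proof -
    have "dot F (indicator {x}) (w i) = w i x" if "x \<in> F" for x i
      using that assms(2) by (simp add: dot_def indicator_def sum.delta' if_distrib[of "\<lambda>a. a * _"] cong: if_cong)
    then show ?thesis
      by (simp add: sum_divide_distrib) (rule sum.swap)
  qed
  also have "\<dots> \<le> (\<Sum>x\<in>F. dot F (indicator {x}) (indicator {x}))"
    unfolding w_def by (intro sum_mono bessel assms(2) h)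
  also have "\<dots> = (\<Sum>x\<in>F. 1)"
    using assms(2) by (intro sum.cong) (auto simp: dot_def indicator_def if_distrib[of "\<lambda>a. a * _"] cong: if_cong)
  finally show ?thesis by simp
qed

text \<open>Each new function needs at most one more point. If it agrees on \<open>F\<close> with a
  combination of its predecessors, that combination is unique by independence on \<open>F\<close>,
  and a point where the agreement fails is added.\<close>

lemma ex_finite_indep_on:
  assumes "indep_on UNIV f K"
  shows "\<exists>F. finite F \<and> indep_on F f K"
  using assms
proof (induction K)
  case 0
  then show ?case by (intro exI[of _ "{}"]) (simp add: indep_on_def)
next
  case (Suc K)
  have "indep_on UNIV f K"
    unfolding indep_on_def
  proof (intro allI impI)
    fix c i assume c: "\<forall>x\<in>UNIV. (\<Sum>i<K. c i * f i x) = 0" and i: "i < K"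
    then have "\<forall>x\<in>UNIV. (\<Sum>i<Suc K. (c(K := 0)) i * f i x) = 0" by simp
    then have "\<forall>i<Suc K. (c(K := 0)) i = 0" using Suc.prems unfolding indep_on_def by blast
    then show "c i = 0" using i by (metis fun_upd_other less_Suc_eq less_irrefl)
  qed
  then obtain F where F: "finite F" "indep_on F f K" using Suc.IH by blast
  show ?case
  proof (cases "\<exists>c. \<forall>x\<in>F. f K x = (\<Sum>i<K. c i * f i x)")
    case True
    then obtain c where c: "\<And>x. x \<in> F \<Longrightarrow> f K x = (\<Sum>i<K. c i * f i x)" by blast
    have "\<exists>x. f K x \<noteq> (\<Sum>i<K. c i * f i x)"
    proof (rule ccontr)
      assume "\<nexists>x. f K x \<noteq> (\<Sum>i<K. c i * f i x)"
      then have "\<forall>x\<in>UNIV. (\<Sum>i<Suc K. (c(K := - 1)) i * f i x) = 0" by simp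
      then have "(c(K := - 1)) K = 0" using Suc.prems unfolding indep_on_def by blast
      then show False by simp
    qed
    then obtain y where y: "f K y \<noteq> (\<Sum>i<K. c i * f i y)" by blast
    have "indep_on (insert y F) f (Suc K)"
      unfolding indep_on_def
    proof (intro allI impI)
      fix d i assume d: "\<forall>x\<in>insert y F. (\<Sum>i<Suc K. d i * f i x) = 0" and i: "i < Suc K"
      have "\<forall>x\<in>F. (\<Sum>i<K. (d i + d K * c i) * f i x) = 0"
      proof
        fix x assume x: "x \<in> F"
        then have "(\<Sum>i<Suc K. d i * f i x) = 0" using d by blast
        then have "(\<Sum>i<K. d i * f i x) + d K * (\<Sum>i<K. c i * f i x) = 0" using c[OF x] by simp
        then show "(\<Sum>i<K. (d i + d K * c i) * f i x) = 0"
          by (simp add: distrib_right sum.distrib sum_distrib_left mult.assoc)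
      qed
      then have e: "d i = - (d K * c i)" if "i < K" for i
      proof -
        have "(\<forall>x\<in>F. (\<Sum>i<K. (d i + d K * c i) * f i x) = 0) \<longrightarrow> (\<forall>i<K. d i + d K * c i = 0)"
          using F(2) unfolding indep_on_def by (rule spec)
        then have "d i + d K * c i = 0"
          using that \<open>\<forall>x\<in>F. (\<Sum>i<K. (d i + d K * c i) * f i x) = 0\<close> by simp
        then show ?thesis by simp
      qed
      have "0 = (\<Sum>i<K. d i * f i y) + d K * f K y" using d by simp
      also have "(\<Sum>i<K. d i * f i y) = - d K * (\<Sum>i<K. c i * f i y)"
        using e by (simp add: sum_distrib_left mult.assoc sum_negf)
      finally have "d K * (f K y - (\<Sum>i<K. c i * f i y)) = 0" unfolding right_diff_distrib by linarith
      then have "d K = 0" using y by auto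
      then show "d i = 0" using e i by (cases "i = K") auto
    qed
    then show ?thesis using F(1) by blast
  next
    case False
    have "indep_on F f (Suc K)"
      unfolding indep_on_def
    proof (intro allI impI)
      fix d i assume d: "\<forall>x\<in>F. (\<Sum>i<Suc K. d i * f i x) = 0" and i: "i < Suc K"
      have "d K = 0"
      proof (rule ccontr)
        assume dK: "d K \<noteq> 0"
        have "f K x = (\<Sum>i<K. - d i / d K * f i x)" if "x \<in> F" for x
        proof -
          have "d K * f K x = - (\<Sum>i<K. d i * f i x)" using d that by (simp add: add_eq_0_iff2)
          then have "f K x = - (\<Sum>i<K. d i * f i x) / d K" using dK by (simp add: field_simps)
          then show ?thesis by (simp add: sum_negf sum_divide_distrib)
        qed
        then show False using False by (auto dest: spec[of _ "\<lambda>i. - d i / d K"])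
      qed
      moreover have "d i = 0" if "i < K" for i
        using d \<open>d K = 0\<close> F(2) that unfolding indep_on_def by simp
      ultimately show "d i = 0" using i by (cases "i = K") auto
    qed
    then show ?thesis using F(1) by blast
  qed
qed

subsection \<open>Counting independent harmonic functions\<close>

lemma laplacian_diff: "laplacian E (\<lambda>x. u x - v x) x = laplacian E u x - laplacian E v x"
  unfolding laplacian_def sum_subtractf[symmetric] by (intro sum.cong) auto

lemma laplacian_sum: "laplacian E (\<lambda>x. \<Sum>j\<in>J. c j * f j x) x = (\<Sum>j\<in>J. c j * laplacian E (f j) x)"
proof -
  have "laplacian E (\<lambda>x. \<Sum>j\<in>J. c j * f j x) x = (\<Sum>y\<in>{y. E x y}. \<Sum>j\<in>J. c j * (f j y - f j x))"
    unfolding laplacian_def by (simp add: right_diff_distrib sum_subtractf)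
  also have "\<dots> = (\<Sum>j\<in>J. \<Sum>y\<in>{y. E x y}. c j * (f j y - f j x))" by (rule sum.swap)
  finally show ?thesis by (simp add: laplacian_def sum_distrib_left)
qed

section \<open>Choice of scale and averaging over radii\<close>

lemma ex_slow_growth:
  fixes g :: "nat \<Rightarrow> real" and a b e :: real
  assumes "\<And>k. k \<ge> k\<^sub>0 \<Longrightarrow> g k \<le> a + b * k" and e: "e > 0"
  shows "\<exists>k\<ge>k\<^sub>0. g (Suc k) - g k \<le> b + e"
proof (rule ccontr)
  assume "\<not> ?thesis"
  then have step: "g (Suc k) > g k + b + e" if "k \<ge> k\<^sub>0" for k using that by force
  have low: "g (k\<^sub>0 + m) \<ge> g k\<^sub>0 + m * (b + e)" for m
  proof (induction m)
    case (Suc m)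
    then show ?case using step[of "k\<^sub>0 + m"] by (simp add: distrib_right)
  qed simp
  obtain m :: nat where m: "a + b * k\<^sub>0 - g k\<^sub>0 < m * e" using reals_Archimedean3[OF e] by blast
  have "g k\<^sub>0 + m * (b + e) \<le> a + b * (k\<^sub>0 + m)" using low[of m] assms(1)[of "k\<^sub>0 + m"] by simp
  then show False using m by (simp add: algebra_simps)
qed

lemma sum_inverse_squares_le: "(\<Sum>j<n. 1 / (real j + 1)\<^sup>2) \<le> 2"
proof -
  have "(\<Sum>j<n. 1 / (real j + 1)\<^sup>2) \<le> (\<Sum>j<n. 2 * (1 / (real j + 1) - 1 / (real (Suc j) + 1)))"
  proof (rule sum_mono)
    fix j
    have "1 / (real j + 1) - 1 / (real (Suc j) + 1) = 1 / ((real j + 1) * (real j + 2))"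
      by (simp add: field_simps)
    moreover have "1 / (real j + 1)\<^sup>2 \<le> 2 / ((real j + 1) * (real j + 2))"
    proof -
      have "1 / (real j + 1)\<^sup>2 = 2 / ((real j + 1) * (2 * (real j + 1)))"
        by (subst mult_divide_mult_cancel_left[of 2 1 "(real j + 1)\<^sup>2", symmetric])
          (auto simp: power2_eq_square algebra_simps)
      also have "\<dots> \<le> 2 / ((real j + 1) * (real j + 2))"
        by (intro divide_left_mono mult_left_mono mult_pos_pos) auto
      finally show ?thesis .
    qed
    ultimately show "1 / (real j + 1)\<^sup>2 \<le> 2 * (1 / (real j + 1) - 1 / (real (Suc j) + 1))" by simp
  qed
  also have "\<dots> = 2 * (\<Sum>j<n. 1 / (real j + 1) - 1 / (real (Suc j) + 1))" by (simp add: sum_distrib_left)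
  also have "\<dots> = 2 * (1 - 1 / (real n + 1))"
    using sum_lessThan_telescope'[of "\<lambda>j. 1 / (real j + 1)" n] by simp
  also have "\<dots> \<le> 2" by simp
  finally show ?thesis .
qed

text \<open>The terms that pass the cutoff T / 4 start at some index m, and the one with index i is
  at least (T / 4) (i - m + 1), so the sum is dominated by inverse squares. The number
  \<open>a\<close> is arbitrary: the bound is uniform in the position of the group element relative
  to the spheres.\<close>

lemma sum_spaced_le:
  fixes T :: real
  assumes T: "T > 0" and D: "D \<ge> 2"
  shows "(\<Sum>i<n. if T / 4 \<le> a + real i * T then 1 / (a + real i * T) ^ D else 0) \<le> 2 * (4 / T) ^ D"
proof -
  define I where "I = {i. i < n \<and> T / 4 \<le> a + real i * T}"
  have "(\<Sum>i<n. if T / 4 \<le> a + real i * T then 1 / (a + real i * T) ^ D else 0) = (\<Sum>i\<in>I. 1 / (a + real i * T) ^ D)"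
    unfolding I_def by (subst sum.inter_filter[symmetric]) auto
  also have "\<dots> \<le> 2 * (4 / T) ^ D"
  proof (cases "I = {}")
    case False
    define m where "m = Min I"
    have fin: "finite I" unfolding I_def by simp
    have m: "m \<in> I" "\<And>i. i \<in> I \<Longrightarrow> m \<le> i" unfolding m_def using False fin by auto
    have "(\<Sum>i\<in>I. 1 / (a + real i * T) ^ D) \<le> (\<Sum>i\<in>I. (4 / T) ^ D * (1 / (real (i - m) + 1)\<^sup>2))"
    proof (rule sum_mono)
      fix i assume i: "i \<in> I"
      have "a + real i * T = a + real m * T + real (i - m) * T" using m(2)[OF i] by (simp add: of_nat_diff algebra_simps)
      moreover have "T / 4 \<le> a + real m * T" using m(1) by (simp add: I_def)
      moreover have "real (i - m) * T \<ge> real (i - m) * (T / 4)" using T by (intro mult_left_mono) auto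
      ultimately have low: "T / 4 * (real (i - m) + 1) \<le> a + real i * T" by (simp add: distrib_left mult.commute)
      have pos: "0 < T / 4 * (real (i - m) + 1)" using T by simp
      have "1 / (a + real i * T) ^ D \<le> 1 / (T / 4 * (real (i - m) + 1)) ^ D"
        using low pos T by (intro divide_left_mono power_mono mult_pos_pos zero_less_power; linarith)
      also have "\<dots> = (4 / T) ^ D * (1 / (real (i - m) + 1) ^ D)"
        unfolding power_mult_distrib using T by (simp add: power_divide)
      also have "\<dots> \<le> (4 / T) ^ D * (1 / (real (i - m) + 1)\<^sup>2)"
        using T D by (intro mult_left_mono divide_left_mono power_increasing) auto
      finally show "1 / (a + real i * T) ^ D \<le> (4 / T) ^ D * (1 / (real (i - m) + 1)\<^sup>2)" .
    qed
    also have "\<dots> = (4 / T) ^ D * (\<Sum>i\<in>I. 1 / (real (i - m) + 1)\<^sup>2)" by (simp add: sum_distrib_left)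
    also have "(\<Sum>i\<in>I. 1 / (real (i - m) + 1)\<^sup>2) = (\<Sum>j\<in>(\<lambda>i. i - m) ` I. 1 / (real j + 1)\<^sup>2)"
    proof (subst sum.reindex)
      show "inj_on (\<lambda>i. i - m) I"
      proof (rule inj_onI)
        fix x y assume "x \<in> I" "y \<in> I" "x - m = y - m"
        then show "x = y" using m(2)[of x] m(2)[of y] by linarith
      qed
    qed simp
    also have "\<dots> \<le> (\<Sum>j<n. 1 / (real j + 1)\<^sup>2)" by (intro sum_mono2) (auto simp: I_def)
    also note sum_inverse_squares_le
    finally show ?thesis using T by (simp add: mult.commute mult_left_mono)
  qed (use T in simp)
  finally show ?thesis .
qed

context rough_graph
begin

definition polynomial_family :: "(nat \<Rightarrow> 'a \<Rightarrow> real) \<Rightarrow> nat \<Rightarrow> real \<Rightarrow> bool" where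
  "polynomial_family f K d \<longleftrightarrow> indep_on UNIV f K \<and> (\<forall>i<K. (\<forall>x. laplacian E (f i) x = 0) \<and>
     (\<exists>A. \<forall>x. \<bar>f i x\<bar> \<le> A * (real (len (\<phi> x)) + 1) powr d))"

lemma indep_on_pull:
  assumes "indep_on UNIV f K"
  shows "\<exists>r\<^sub>1\<ge>1. \<forall>r\<ge>r\<^sub>1. indep_on (pull 0 r) f K"
proof -
  obtain F where F: "finite F" "indep_on F f K" using ex_finite_indep_on[OF assms] by blast
  define m where "m = Max (insert 1 ((\<lambda>x. real (len (\<phi> x))) ` F))"
  have "F \<subseteq> pull 0 r" if "r \<ge> m" for r
  proof
    fix x assume "x \<in> F"
    then have "real (len (\<phi> x)) \<le> m" unfolding m_def using F(1) by (intro Max_ge) auto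
    then show "x \<in> pull 0 r" using that by (simp add: mem_pull_zero)
  qed
  moreover have "m \<ge> 1" unfolding m_def using F(1) by (intro Max_ge) auto
  ultimately show ?thesis using indep_on_mono[OF F(2)] by blast
qed

text \<open>The exponent 2 d + D combines the squared growth with the volume. The constant depends
  on the family through \<open>A\<close>, but not on \<open>r\<close>.\<close>

lemma ln_height_le:
  fixes A d r :: real
  assumes f: "\<And>x. \<bar>f i x\<bar> \<le> A * (real (len (\<phi> x)) + 1) powr d" and d: "d \<ge> 0"
    and r: "r \<ge> 1" and pos: "0 < height (pull 0 r) f i"
  shows "ln (height (pull 0 r) f i) \<le> ln ((\<bar>A\<bar> + 1)\<^sup>2 * 2 powr (2 * d) * (M * c\<^sub>2 + 1)) + (2 * d + D) * ln r"
proof -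
  have ptw: "(f i x)\<^sup>2 \<le> (\<bar>A\<bar> + 1)\<^sup>2 * (2 * r) powr (2 * d)" if "x \<in> pull 0 r" for x
  proof -
    have "\<bar>f i x\<bar> \<le> (\<bar>A\<bar> + 1) * (real (len (\<phi> x)) + 1) powr d"
      by (rule order_trans[OF f]) (intro mult_right_mono, auto)
    also have "\<dots> \<le> (\<bar>A\<bar> + 1) * (2 * r) powr d"
      using that r d by (intro mult_left_mono powr_mono2) (auto simp: mem_pull_zero)
    finally have "\<bar>f i x\<bar>\<^sup>2 \<le> ((\<bar>A\<bar> + 1) * (2 * r) powr d)\<^sup>2" by (intro power_mono) auto
    also have "\<dots> = (\<bar>A\<bar> + 1)\<^sup>2 * (2 * r) powr (2 * d)"
      by (simp add: power2_eq_square flip: powr_add)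
    finally show ?thesis by simp
  qed
  have "height (pull 0 r) f i \<le> (\<Sum>x\<in>pull 0 r. (f i x)\<^sup>2)"
    using height_le_self[of "pull 0 r" f i] by (simp add: dot_self)
  also have "\<dots> \<le> (\<Sum>x\<in>pull 0 r. (\<bar>A\<bar> + 1)\<^sup>2 * (2 * r) powr (2 * d))" by (intro sum_mono ptw)
  also have "\<dots> = (\<bar>A\<bar> + 1)\<^sup>2 * (2 * r) powr (2 * d) * card (pull 0 r)" by simp
  also have "\<dots> \<le> (\<bar>A\<bar> + 1)\<^sup>2 * (2 * r) powr (2 * d) * ((M * c\<^sub>2 + 1) * r ^ D)"
  proof (intro mult_left_mono)
    have "real (card (pull 0 r)) \<le> M * real (card (gball 0 r))"
      using card_pull[of 0 r] by (metis of_nat_mono of_nat_mult)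
    also have "\<dots> \<le> M * (c\<^sub>2 * r ^ D)" using gball_upper r by (intro mult_left_mono) auto
    also have "\<dots> \<le> (M * c\<^sub>2 + 1) * r ^ D" using r by (simp add: distrib_right)
    finally show "real (card (pull 0 r)) \<le> (M * c\<^sub>2 + 1) * r ^ D" .
  qed auto
  also have "\<dots> = ((\<bar>A\<bar> + 1)\<^sup>2 * 2 powr (2 * d) * (M * c\<^sub>2 + 1)) * r powr (2 * d + D)"
    using r by (simp add: powr_mult powr_add powr_realpow)
  finally have le: "height (pull 0 r) f i \<le> \<dots>" .
  have p: "0 < (\<bar>A\<bar> + 1)\<^sup>2 * 2 powr (2 * d) * (M * c\<^sub>2 + 1)"
    using c\<^sub>2 by (intro mult_pos_pos add_nonneg_pos) auto
  have "ln (height (pull 0 r) f i) \<le> ln (((\<bar>A\<bar> + 1)\<^sup>2 * 2 powr (2 * d) * (M * c\<^sub>2 + 1)) * r powr (2 * d + D))"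
    using le pos by (subst ln_le_cancel_iff) auto
  also have "\<dots> = ln ((\<bar>A\<bar> + 1)\<^sup>2 * 2 powr (2 * d) * (M * c\<^sub>2 + 1)) + (2 * d + D) * ln r"
    using p r by (subst ln_mult_pos) (auto simp: ln_powr)
  finally show ?thesis .
qed

text \<open>After exchanging the sums, each \<open>h\<close> contributes an arithmetic progression
  with step \<open>T\<close>, whatever its length; the number of relevant \<open>h\<close> is
  bounded by one ball volume. With L \<le> T / 2 the inner half of the gap leaves distances of at
  least (T - L) / 2 \<ge> T / 4.\<close>

lemma sum_volumes_le:
  fixes T :: real
  assumes D: "D \<ge> 2" and n: "n \<ge> 1" and T: "T \<ge> 1" "T \<ge> 2 * real L"
  shows "(\<Sum>i<n. \<Sum>h\<in>gball 0 (((real (n + Suc i) * T - L) + real (n + i) * T) / 2).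
            1 / ((real (n + Suc i) * T - L) - len h) ^ D) \<le> 2 * 8 ^ D * c\<^sub>2 * n ^ D"
proof -
  define \<tau> where "\<tau> i h = (real (n + 1) * T - L - len h) + real i * T" for i h
  have \<tau>: "real (n + Suc i) * T - L - len h = \<tau> i h" for i h
    unfolding \<tau>_def by (simp add: algebra_simps)
  define H where "H = gball 0 (2 * real n * T)"
  have "(\<Sum>i<n. \<Sum>h\<in>gball 0 (((real (n + Suc i) * T - L) + real (n + i) * T) / 2). 1 / \<tau> i h ^ D)
      \<le> (\<Sum>i<n. \<Sum>h\<in>H. if T / 4 \<le> \<tau> i h then 1 / \<tau> i h ^ D else 0)"
  proof (rule sum_mono)
    fix i assume i: "i \<in> {..<n}"
    let ?B = "gball 0 (((real (n + Suc i) * T - L) + real (n + i) * T) / 2)"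
    have "T / 4 \<le> \<tau> i h" "h \<in> H" if "h \<in> ?B" for h
    proof -
      have lh: "real (len h) \<le> ((real (n + Suc i) * T - L) + real (n + i) * T) / 2"
        using that by (simp add: gball_def)
      have "real (n + Suc i) * T = real (n + i) * T + T" by (simp add: algebra_simps)
      with lh T show "T / 4 \<le> \<tau> i h" unfolding \<tau>[symmetric] by argo
      have "real (n + Suc i) * T \<le> (2 * real n) * T" "real (n + i) * T \<le> (2 * real n) * T"
        using i T by (intro mult_right_mono; simp)+
      with lh show "h \<in> H" by (simp add: H_def gball_def)
    qed
    note B = this
    have "(\<Sum>h\<in>?B. 1 / \<tau> i h ^ D) = (\<Sum>h\<in>?B. if T / 4 \<le> \<tau> i h then 1 / \<tau> i h ^ D else 0)"
      using B by (intro sum.cong) auto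
    also have "\<dots> \<le> (\<Sum>h\<in>H. if T / 4 \<le> \<tau> i h then 1 / \<tau> i h ^ D else 0)"
      using B(2) T by (intro sum_mono2) (auto simp: H_def)
    finally show "(\<Sum>h\<in>?B. 1 / \<tau> i h ^ D) \<le> \<dots>" .
  qed
  also have "\<dots> = (\<Sum>h\<in>H. \<Sum>i<n. if T / 4 \<le> \<tau> i h then 1 / \<tau> i h ^ D else 0)" by (rule sum.swap)
  also have "\<dots> \<le> (\<Sum>h\<in>H. 2 * (4 / T) ^ D)"
    unfolding \<tau>_def using D T by (intro sum_mono sum_spaced_le) auto
  also have "\<dots> = card H * (2 * (4 / T) ^ D)" by simp
  also have "\<dots> \<le> (c\<^sub>2 * (2 * real n * T) ^ D) * (2 * (4 / T) ^ D)"
  proof (intro mult_right_mono)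
    have "1 * 1 \<le> (2 * real n) * T" using n T by (intro mult_mono) auto
    then show "real (card H) \<le> c\<^sub>2 * (2 * real n * T) ^ D" unfolding H_def by (intro gball_upper) simp
  qed (use T in auto)
  also have "\<dots> = 2 * c\<^sub>2 * ((2 * real n * T) * (4 / T)) ^ D" unfolding power_mult_distrib by simp
  also have "(2 * real n * T) * (4 / T) = 8 * real n" using T by simp
  finally show ?thesis unfolding \<tau> by (simp add: power_mult_distrib mult_ac)
qed

lemma card_family_le:
  assumes D: "D \<ge> 2"
  shows "\<exists>C. \<forall>d\<ge>1. \<forall>K f. polynomial_family f K d \<longrightarrow> real K \<le> C * d ^ (D - 1)"
proof -
  \<comment> \<open>The summand D + 3 bounds the average growth of the log determinant per step and
    per function, the other one the average volume divided by n^(D-1). Taking half of exp (-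
    \<sigma>) for \<delta> lets the term \<delta> K be absorbed at the end.\<close>
  define \<sigma> where "\<sigma> = real D + 3 + 2 * 8 ^ D * c\<^sub>2"
  define \<delta> where "\<delta> = exp (- \<sigma>) / 2"
  have \<sigma>: "\<sigma> > 0" unfolding \<sigma>_def using c\<^sub>2 by (simp add: add_nonneg_pos add_pos_pos)
  have "\<delta> > 0" unfolding \<delta>_def by simp
  then obtain C T\<^sub>0 where C: "C > 0" "\<And>\<rho> R. \<rho> - R \<ge> T\<^sub>0 \<Longrightarrow> whitney_bound \<delta> C \<rho> R"
    using whitney_estimate by blast
  have main: "real K \<le> 2 * exp \<sigma> * C * \<sigma> * 2 ^ (D - 1) * d ^ (D - 1)"
    if d: "d \<ge> 1" and fam: "polynomial_family f K d" for d K f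
  proof (cases "K = 0")
    case True
    then show ?thesis using \<sigma> C d by simp
  next
    case False
    define n where "n = nat \<lceil>d\<rceil>"
    have n: "real n \<ge> d" "real n \<le> 2 * d" "n \<ge> 1" using d unfolding n_def by linarith+
    obtain r\<^sub>1 where r1: "r\<^sub>1 \<ge> 1" "\<And>r. r \<ge> r\<^sub>1 \<Longrightarrow> indep_on (pull 0 r) f K"
      using indep_on_pull fam unfolding polynomial_family_def by blast
    have hpos: "0 < height (pull 0 r) f i" if "r \<ge> r\<^sub>1" "i < K" for r i
      using indep_on_height_pos[OF r1(2)[OF that(1)] finite_pull that(2)] .
    define \<Phi> where "\<Phi> r = (\<Sum>i<K. ln (height (pull 0 r) f i))" for r
    have \<Phi>_mono: "\<Phi> r \<le> \<Phi> r'" if "r\<^sub>1 \<le> r" "r \<le> r'" for r r'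
      unfolding \<Phi>_def
    proof (rule sum_mono)
      fix i assume "i \<in> {..<K}"
      then have "0 < height (pull 0 r) f i" using hpos that by auto
      moreover have "height (pull 0 r) f i \<le> height (pull 0 r') f i"
        using that by (intro height_mono) (auto simp: mem_pull_zero)
      ultimately show "ln (height (pull 0 r) f i) \<le> ln (height (pull 0 r') f i)" by simp
    qed
    have "\<forall>i\<in>{..<K}. \<exists>A. \<forall>x. \<bar>f i x\<bar> \<le> A * (real (len (\<phi> x)) + 1) powr d"
      using fam unfolding polynomial_family_def by blast
    then obtain A where A: "\<And>i x. i < K \<Longrightarrow> \<bar>f i x\<bar> \<le> A i * (real (len (\<phi> x)) + 1) powr d"
      by (metis lessThan_iff)
    define a where "a = (\<Sum>i<K. ln ((\<bar>A i\<bar> + 1)\<^sup>2 * 2 powr (2 * d) * (M * c\<^sub>2 + 1)))"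
    have \<Phi>_le: "\<Phi> r \<le> a + K * (2 * d + D) * ln r" if r: "r \<ge> r\<^sub>1" for r
    proof -
      have "\<Phi> r \<le> (\<Sum>i<K. ln ((\<bar>A i\<bar> + 1)\<^sup>2 * 2 powr (2 * d) * (M * c\<^sub>2 + 1)) + (2 * d + D) * ln r)"
        unfolding \<Phi>_def using r r1 d by (intro sum_mono ln_height_le A hpos) auto
      then show ?thesis by (simp add: a_def sum.distrib mult.assoc)
    qed
    define b where "b = real K * (2 * d + D) * ln 2"
    \<comment> \<open>The entries ensure, in this order, the volume bounds, independence on all
      balls considered, the margin T / 4 in the volume average, and the Whitney gap T - L.\<close>
    define T\<^sub>1 where "T\<^sub>1 = Max {1, r\<^sub>1, 2 * real L, T\<^sub>0 + L}"
    obtain k\<^sub>0 :: nat where k0: "T\<^sub>1 < 2 ^ k\<^sub>0" using real_arch_pow[of 2 T\<^sub>1] by auto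
    have T1: "1 \<le> T\<^sub>1" "r\<^sub>1 \<le> T\<^sub>1" "2 * real L \<le> T\<^sub>1" "T\<^sub>0 + L \<le> T\<^sub>1" unfolding T\<^sub>1_def by simp_all
    have big: "T\<^sub>1 \<le> 2 ^ k" if "k \<ge> k\<^sub>0" for k
      using k0 power_increasing[OF that, of "2::real"] by linarith
    \<comment> \<open>Over all large doublings of the radius the log determinant grows at most at
      rate \<open>b\<close>, so one doubling costs at most \<open>b\<close> plus the margin
      \<open>K\<close>. The family-dependent constant \<open>a\<close> disappears here; it affects
      only which \<open>k\<close> is found.\<close>
    have "\<exists>k\<ge>k\<^sub>0. \<Phi> (real n * 2 ^ Suc k) - \<Phi> (real n * 2 ^ k) \<le> b + real K"
    proof (rule ex_slow_growth[where a = "a + K * (2 * d + D) * ln n"])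
      fix k assume k: "k \<ge> k\<^sub>0"
      have "1 * 2 ^ k \<le> real n * 2 ^ k" using n by (intro mult_right_mono) auto
      then have "r\<^sub>1 \<le> real n * 2 ^ k" using T1 big[OF k] by linarith
      then have "\<Phi> (real n * 2 ^ k) \<le> a + K * (2 * d + D) * ln (real n * 2 ^ k)" by (rule \<Phi>_le)
      also have "ln (real n * 2 ^ k) = ln (real n) + k * ln 2" using n by (simp add: ln_mult ln_realpow)
      finally show "\<Phi> (real n * 2 ^ k) \<le> a + K * (2 * d + D) * ln n + b * k"
        by (simp add: b_def algebra_simps)
    qed (use False in simp)
    then obtain k where k: "k \<ge> k\<^sub>0" "\<Phi> (real n * 2 ^ Suc k) - \<Phi> (real n * 2 ^ k) \<le> b + real K" by blast
    define T :: real where "T = 2 ^ k"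
    have T: "T \<ge> 1" "T \<ge> r\<^sub>1" "T \<ge> 2 * real L" "T \<ge> T\<^sub>0 + L" using T1 big[OF k(1)] unfolding T_def by linarith+
    define R where "R i = real (n + i) * T" for i
    \<comment> \<open>Subtracting \<open>L\<close> makes the outer ball of radius \<rho> + L in the
      Whitney estimate equal to the next ball, so consecutive steps fit together.\<close>
    define \<rho> where "\<rho> i = R (Suc i) - L" for i
    define s where "s i = (\<Sum>h\<in>gball 0 ((\<rho> i + R i) / 2). 1 / (\<rho> i - len h) ^ D)" for i
    have RS: "R (Suc i) = R i + T" for i unfolding R_def by (simp add: algebra_simps)
    have R_ge: "R i \<ge> r\<^sub>1" for i
    proof -
      have "1 * T \<le> R i" unfolding R_def using n T by (intro mult_right_mono) auto
      then show ?thesis using T by simp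
    qed
    have "(\<Sum>i<n. \<Phi> (R (Suc i)) - \<Phi> (R i)) = \<Phi> (R n) - \<Phi> (R 0)"
      using sum_lessThan_telescope[of "\<lambda>i. \<Phi> (R i)" n] by simp
    also have "\<dots> \<le> b + real K" using k(2) unfolding R_def T_def by (simp add: mult_ac)
    also have "b \<le> real K * (2 * d + D) * 1" unfolding b_def using d ln2_le_25_over_36 by (intro mult_left_mono) auto
    finally have "(\<Sum>i<n. \<Phi> (R (Suc i)) - \<Phi> (R i)) \<le> K * (2 * d + D + 1)" by (simp add: algebra_simps)
    also have "\<dots> \<le> K * (real n * (real D + 3))"
    \<comment> \<open>Here 2 d \<le> 2 n and D + 1 \<le> n (D + 1); the first inequality is why the
      number of steps is at least \<open>d\<close>.\<close>
    proof (intro mult_left_mono)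
      have "real D + 1 \<le> real n * (real D + 1)" using n by simp
      then show "2 * d + real D + 1 \<le> real n * (real D + 3)" using n by (simp add: algebra_simps)
    qed auto
    finally have sum1: "(\<Sum>i<n. \<Phi> (R (Suc i)) - \<Phi> (R i)) / K \<le> real n * (real D + 3)"
      using False by (simp add: divide_le_eq mult.commute)
    have "(\<Sum>i<n. s i) \<le> 2 * 8 ^ D * c\<^sub>2 * n ^ D"
      unfolding s_def \<rho>_def R_def using sum_volumes_le[OF D n(3) T(1) T(3)] by simp
    also have "\<dots> = real n * (2 * 8 ^ D * c\<^sub>2) * real n ^ (D - 1)"
      using D by (cases D) (auto simp: mult_ac)
    finally have sum2: "(\<Sum>i<n. s i) / real n ^ (D - 1) \<le> real n * (2 * 8 ^ D * c\<^sub>2)"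
      using n by (simp add: divide_le_eq)
    \<comment> \<open>Both quantities are nonnegative, so an index at which their sum is at most its
      average bound \<sigma> controls each of them.\<close>
    have "\<exists>i<n. (\<Phi> (R (Suc i)) - \<Phi> (R i)) / K + s i / real n ^ (D - 1) \<le> \<sigma>"
    proof (rule ccontr)
      assume "\<not> ?thesis"
      then have "(\<Sum>i<n. \<sigma>) < (\<Sum>i<n. (\<Phi> (R (Suc i)) - \<Phi> (R i)) / K + s i / real n ^ (D - 1))"
        using n by (intro sum_strict_mono) (auto simp: not_le lessThan_empty_iff)
      also have "\<dots> = (\<Sum>i<n. \<Phi> (R (Suc i)) - \<Phi> (R i)) / K + (\<Sum>i<n. s i) / real n ^ (D - 1)"
        by (simp add: sum.distrib sum_divide_distrib)
      also have "\<dots> \<le> real n * (real D + 3) + real n * (2 * 8 ^ D * c\<^sub>2)" using sum1 sum2 by (rule add_mono)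
      also have "\<dots> = (\<Sum>i<n. \<sigma>)" by (simp add: \<sigma>_def algebra_simps)
      finally show False by simp
    qed
    then obtain i where i: "i < n" "(\<Phi> (R (Suc i)) - \<Phi> (R i)) / K + s i / real n ^ (D - 1) \<le> \<sigma>" by blast
    have nonneg: "0 \<le> (\<Phi> (R (Suc i)) - \<Phi> (R i)) / K"
      using \<Phi>_mono[OF R_ge[of i], of "R (Suc i)"] T by (simp add: RS)
    have "0 \<le> s i"
      unfolding s_def
    proof (intro sum_nonneg divide_nonneg_nonneg zero_le_power)
      fix h assume "h \<in> gball 0 ((\<rho> i + R i) / 2)"
      then show "0 \<le> \<rho> i - real (len h)" using T by (simp add: gball_def \<rho>_def RS)
    qed auto
    then have nonneg': "0 \<le> s i / real n ^ (D - 1)" by simp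
    have \<Phi>i: "\<Phi> (R (Suc i)) - \<Phi> (R i) \<le> \<sigma> * K"
    proof -
      have "(\<Phi> (R (Suc i)) - \<Phi> (R i)) / K \<le> \<sigma>" using i nonneg' by linarith
      then show ?thesis using False by (simp add: divide_le_eq)
    qed
    have si: "s i \<le> \<sigma> * real n ^ (D - 1)"
    proof -
      have "s i / real n ^ (D - 1) \<le> \<sigma>" using i nonneg by linarith
      then show ?thesis using n by (simp add: divide_le_eq)
    qed
    have "whitney_bound \<delta> C (\<rho> i) (R i)" using T by (intro C) (simp add: \<rho>_def RS)
    then obtain N Q where N: "finite (N :: 'g set)" "\<And>g. g \<in> N \<Longrightarrow> Q g \<noteq> {} \<and> Q g \<subseteq> pull 0 (R (Suc i))"
      "card N \<le> C * s i"
      "\<And>u. (\<And>x. laplacian E u x = 0) \<Longrightarrow> (\<Sum>x\<in>pull 0 (R i). (u x)\<^sup>2)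
           \<le> \<delta> * (\<Sum>x\<in>pull 0 (R (Suc i)). (u x)\<^sup>2) + (\<Sum>g\<in>N. (\<Sum>x\<in>Q g. u x)\<^sup>2 / card (Q g))"
      unfolding whitney_bound_def s_def by (auto simp: \<rho>_def)
    have "K * exp (- \<sigma>) \<le> \<delta> * K + card N"
    proof (rule dimension_le_sampling[where A = "pull 0 (R i)" and B = "pull 0 (R (Suc i))" and f = f and Q = Q])
      show "pull 0 (R i) \<subseteq> pull 0 (R (Suc i))" using T by (auto simp: mem_pull_zero RS)
      show "(\<Sum>j<K. ln (height (pull 0 (R (Suc i))) f j) - ln (height (pull 0 (R i)) f j)) \<le> \<sigma> * K"
        using \<Phi>i by (simp add: \<Phi>_def sum_subtractf)
      fix j c assume j: "j < K"
      then have "laplacian E (\<lambda>x. f j x - (\<Sum>l<j. c l * f l x)) x = 0" for x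
        using fam by (simp add: laplacian_diff laplacian_sum polynomial_family_def)
      then show "let u = (\<lambda>x. f j x - (\<Sum>l<j. c l * f l x)) in (\<Sum>x\<in>pull 0 (R i). (u x)\<^sup>2)
           \<le> \<delta> * (\<Sum>x\<in>pull 0 (R (Suc i)). (u x)\<^sup>2) + (\<Sum>g\<in>N. (\<Sum>x\<in>Q g. u x)\<^sup>2 / card (Q g))"
        unfolding Let_def by (rule N(4))
    qed (use N(1,2) hpos R_ge in auto)
    also have "card N \<le> C * (\<sigma> * real n ^ (D - 1))"
      using N(3) si C(1) by (meson dual_order.trans less_imp_le mult_left_mono)
    also have "real n ^ (D - 1) \<le> (2 * d) ^ (D - 1)" using n by (intro power_mono) auto
    finally have "K * exp (- \<sigma>) \<le> \<delta> * K + C * (\<sigma> * (2 * d) ^ (D - 1))"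
      using C(1) \<sigma> by simp
    moreover have "\<delta> * K = K * exp (- \<sigma>) / 2" by (simp add: \<delta>_def)
    ultimately have "K * exp (- \<sigma>) \<le> 2 * (C * (\<sigma> * (2 * d) ^ (D - 1)))" by linarith
    then have "exp \<sigma> * (K * exp (- \<sigma>)) \<le> exp \<sigma> * (2 * (C * (\<sigma> * (2 * d) ^ (D - 1))))"
      by (intro mult_left_mono) auto
    then show ?thesis by (simp add: exp_minus power_mult_distrib mult_ac)
  qed
  then show ?thesis by blast
qed

text \<open>A positive maximum over the ball spreads to all neighbors. It cannot enter the layer,
  where \<open>u\<close> vanishes, and an edge cannot jump across a layer of width \<open>L\<close>;
  by connectedness it reaches \<open>p\<close>. The point \<open>p\<close> excludes nonzero
  constants when the layer is empty.\<close>

lemma maximum_principle: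
  fixes u :: "'a \<Rightarrow> real"
  assumes harm: "\<And>x. laplacian E u x = 0" and p: "u p = 0"
    and layer: "\<And>x. r < len (\<phi> x) \<Longrightarrow> len (\<phi> x) \<le> r + L \<Longrightarrow> u x = 0"
    and x: "len (\<phi> x) \<le> r"
  shows "u x \<le> 0"
proof (rule ccontr)
  assume ux: "\<not> u x \<le> 0"
  define W where "W = pull 0 r"
  have W: "y \<in> W \<longleftrightarrow> len (\<phi> y) \<le> r" for y by (simp add: W_def mem_pull_zero)
  have fin: "finite (u ` W)" by (simp add: W_def)
  define m where "m = Max (u ` W)"
  have m_ge: "u y \<le> m" if "y \<in> W" for y unfolding m_def using fin that by (intro Max_ge) auto
  have m: "m > 0" using m_ge[of x] ux x W by auto
  have "m \<in> u ` W" unfolding m_def using fin x W by (intro Max_in) auto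
  then obtain x\<^sub>0 where x0: "x\<^sub>0 \<in> W" "u x\<^sub>0 = m" by auto
  have step: "z \<in> W \<and> u z = m" if y: "y \<in> W" "u y = m" and z: "E y z" for y z
  proof -
    have near: "len (\<phi> z) \<le> r + L" if "E y z" for z
      using len_triangle[of 0 "\<phi> z" "\<phi> y"] stretch[OF that] y(1) by (simp add: W)
    have le: "0 \<le> m - u z" if "E y z" for z
      using m_ge[of z] layer[OF _ near[OF that]] m by (cases "z \<in> W") (auto simp: W)
    have "(\<Sum>z\<in>{z. E y z}. m - u z) = 0"
      using harm[of y] y(2) unfolding laplacian_def by (simp add: sum_subtractf)
    then have "u z = m" using le z by (subst (asm) sum_nonneg_eq_0_iff) auto
    moreover have "z \<in> W" using layer[OF _ near[OF z]] \<open>u z = m\<close> m by (auto simp: W not_le[symmetric])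
    ultimately show ?thesis by simp
  qed
  obtain n where "walk E n x\<^sub>0 p" using ex_walk by blast
  then have "u p = m"
  proof -
    have "z \<in> W \<and> u z = m" if "walk E n x\<^sub>0 z" for n z
      using that
    proof (induction n arbitrary: z)
      case 0
      then show ?case using x0 by (auto simp: walk_def)
    next
      case (Suc n)
      from Suc.prems obtain y where "walk E n x\<^sub>0 y" "E y z" by (rule walk_SucD)
      then show ?case using Suc.IH step by blast
    qed
    then show ?thesis using \<open>walk E n x\<^sub>0 p\<close> by blast
  qed
  then show False using p m by simp
qed

text \<open>For \<open>D \<le> 1\<close> the graph has arbitrarily large balls with boundary layers of bounded size,
  and a harmonic function on a ball is determined by its values on the layer.\<close>
lemma card_family_le_low_dim:
  assumes D: "D \<le> 1" and fam: "polynomial_family f K d"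
  shows "real K \<le> 2 * M * c\<^sub>2 * L + 1"
proof -
  obtain r\<^sub>1 where r1: "\<And>r. r \<ge> r\<^sub>1 \<Longrightarrow> indep_on (pull 0 r) f K"
    using indep_on_pull fam unfolding polynomial_family_def by blast
  define m where "m = nat \<lceil>\<bar>r\<^sub>1\<bar>\<rceil> + 1"
  have m: "real m \<ge> r\<^sub>1" "m \<ge> 1" unfolding m_def by linarith+
  \<comment> \<open>For i from m to 2 m - 1 these are m disjoint layers inside a ball of volume O(m
    L), so one of them has size bounded independently of m. Starting at m keeps the inner ball large
    enough for independence.\<close>
  define Z where "Z i = {x. i * L < len (\<phi> x) \<and> len (\<phi> x) \<le> i * L + L}" for i
  have Z_sub: "Z i \<subseteq> pull 0 (2 * m * L)" if "i < 2 * m" for i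
  proof
    fix x assume "x \<in> Z i"
    then have "len (\<phi> x) \<le> (i + 1) * L" by (simp add: Z_def)
    also have "\<dots> \<le> 2 * m * L" using that by (intro mult_right_mono) auto
    finally show "x \<in> pull 0 (2 * m * L)" using of_nat_mono[of "len (\<phi> x)" "2 * m * L"] by (simp add: mem_pull_zero)
  qed
  have Z_fin: "finite (Z i)" if "i < 2 * m" for i using Z_sub[OF that] finite_subset finite_pull by metis
  have disj: "Z i \<inter> Z j = {}" if "i < j" for i j
  proof -
    have "i * L + L \<le> j * L" using mult_right_mono[of "i + 1" j L] that by simp
    then show ?thesis by (auto simp: Z_def)
  qed
  have "(\<Sum>i\<in>{m..<2*m}. card (Z i)) = card (\<Union>i\<in>{m..<2*m}. Z i)"
  proof (rule card_UN_disjoint[symmetric])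
    show "\<forall>i\<in>{m..<2*m}. \<forall>j\<in>{m..<2*m}. i \<noteq> j \<longrightarrow> Z i \<inter> Z j = {}"
      using disj by (metis Int_commute linorder_neqE_nat)
  qed (use Z_fin in auto)
  also have "\<dots> \<le> card (pull 0 (2 * m * L))" by (rule card_mono[OF finite_pull], intro UN_least Z_sub) simp
  also have "\<dots> \<le> M * card (gball 0 (2 * m * L))" by (rule card_pull)
  finally have "real (\<Sum>i\<in>{m..<2*m}. card (Z i)) \<le> real M * real (card (gball 0 (2 * m * L)))"
    by (metis of_nat_mono of_nat_mult)
  also have "\<dots> \<le> M * (c\<^sub>2 * (2 * m * L))"
  proof (intro mult_left_mono)
    have "1 * 1 \<le> real m * real L" using m L by (intro mult_mono) auto
    then have mL: "1 \<le> 2 * real m * L" by simp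
    have "card (gball 0 (2 * real m * L)) \<le> c\<^sub>2 * (2 * real m * L) ^ D" using mL by (rule gball_upper)
    also have "\<dots> \<le> c\<^sub>2 * (2 * real m * L) ^ 1"
      using D mL c\<^sub>2 by (intro mult_left_mono power_increasing) auto
    finally show "real (card (gball 0 (2 * m * L))) \<le> c\<^sub>2 * (2 * m * L)" by simp
  qed auto
  finally have total: "(\<Sum>i\<in>{m..<2*m}. real (card (Z i))) \<le> m * (2 * M * c\<^sub>2 * L)" by (simp add: mult_ac)
  have "\<exists>i\<in>{m..<2*m}. real (card (Z i)) \<le> 2 * M * c\<^sub>2 * L"
  proof (rule ccontr)
    assume "\<not> ?thesis"
    then have "(\<Sum>i\<in>{m..<2*m}. 2 * M * c\<^sub>2 * L) < (\<Sum>i\<in>{m..<2*m}. real (card (Z i)))"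
      using m by (intro sum_strict_mono) (auto simp: not_le)
    then show False using total by simp
  qed
  then obtain i where i: "i \<ge> m" "i < 2 * m" "real (card (Z i)) \<le> 2 * M * c\<^sub>2 * L" by auto
  \<comment> \<open>Any vertex will do; it accounts for the summand 1 in the bound.\<close>
  define p :: 'a where "p = undefined"
  have "indep_on (insert p (Z i)) f K"
    unfolding indep_on_def
  proof (intro allI impI)
    fix c j assume c: "\<forall>x\<in>insert p (Z i). (\<Sum>j<K. c j * f j x) = 0" and j: "j < K"
    define u where "u x = (\<Sum>j<K. c j * f j x)" for x
    have harm: "laplacian E u x = 0" for x
      using fam unfolding u_def laplacian_sum polynomial_family_def by simp
    have harm': "laplacian E (\<lambda>x. - u x) x = 0" for x
      using laplacian_diff[of E "\<lambda>_. 0" u x] harm by (simp add: laplacian_def[of E "\<lambda>_. 0"])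
    have uZ: "u x = 0" if "x = p \<or> x \<in> Z i" for x using c that unfolding u_def by blast
    have "u x = 0" if "x \<in> pull 0 (i * L)" for x
    proof -
      have "len (\<phi> x) \<le> i * L" using that unfolding mem_pull_zero of_nat_mult[symmetric] of_nat_le_iff .
      then have "u x \<le> 0" "- u x \<le> 0"
        using maximum_principle[OF harm, of p "i * L" x] maximum_principle[OF harm', of p "i * L" x] uZ
        by (auto simp: Z_def)
      then show ?thesis by simp
    qed
    moreover have "indep_on (pull 0 (i * L)) f K"
    proof (rule r1)
      have "m * 1 \<le> i * L" using i L by (intro mult_mono) auto
      then have "real m \<le> real (i * L)" by (intro of_nat_mono) simp
      then show "r\<^sub>1 \<le> real (i * L)" using m by linarith
    qed
    ultimately show "c j = 0" using j unfolding indep_on_def u_def by blast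
  qed
  then have "K \<le> card (insert p (Z i))" using Z_fin[OF i(2)] by (intro indep_on_card_le) auto
  also have "\<dots> \<le> card (Z i) + 1" using card_insert_le_m1[of "card (Z i) + 1" "Z i" p] by simp
  finally show ?thesis using i(3) by simp
qed

lemma ex_dimension_bound:
  "\<exists>C. \<forall>d\<ge>1. \<forall>K f. polynomial_family f K d \<longrightarrow> real K \<le> C * d ^ (D - 1)"
proof (cases "D \<ge> 2")
  case False
  \<comment> \<open>Subtraction of natural numbers is truncated, so the exponent is 0 for D = 0 as
    well as for D = 1, and the bound is a constant.\<close>
  then have D: "D \<le> 1" "D - 1 = 0" by auto
  show ?thesis unfolding D(2) using card_family_le_low_dim[OF D(1)] by (metis mult.right_neutral power_0)
qed (rule card_family_le)

end

subsection \<open>Passing to the rough isometry and to linear dimension\<close>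

text \<open>Bounded geometry enters here to bound the fibers of the rough isometry, whose points are
  at bounded mutual distance.\<close>

lemma graph_ball_bounds:
  assumes "graph E" "\<And>x. card {y. E x y} \<le> \<Delta>"
  shows "finite {y. gdist E x y \<le> n} \<and> card {y. gdist E x y \<le> n} \<le> (\<Delta> + 1) ^ n"
proof (induction n)
  case 0
  have "{y. gdist E x y \<le> 0} \<subseteq> {x}"
  proof
    fix y assume "y \<in> {y. gdist E x y \<le> 0}"
    moreover have "walk E (gdist E x y) x y" using assms(1) by (intro walk_gdist) (auto simp: graph_def)
    ultimately show "y \<in> {x}" by (auto simp: walk_def)
  qed
  then show ?case using card_mono[of "{x}"] finite_subset by fastforce
next
  case (Suc n)
  define B where "B = {y. gdist E x y \<le> n}"
  have fin: "finite {y. E z y}" for z using assms(1) by (auto simp: graph_def)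
  have sub: "{y. gdist E x y \<le> Suc n} \<subseteq> B \<union> (\<Union>z\<in>B. {y. E z y})"
  proof
    fix y assume y: "y \<in> {y. gdist E x y \<le> Suc n}"
    have w: "walk E (gdist E x y) x y" using assms(1) by (intro walk_gdist) (auto simp: graph_def)
    show "y \<in> B \<union> (\<Union>z\<in>B. {y. E z y})"
    proof (cases "gdist E x y = Suc n")
      case True
      with w obtain z where z: "walk E n x z" "E z y" by (metis walk_SucD)
      then show ?thesis using walk_le[OF z(1)] by (auto simp: B_def)
    qed (use y in \<open>auto simp: B_def\<close>)
  qed
  have B: "finite B" "card B \<le> (\<Delta> + 1) ^ n" using Suc unfolding B_def by auto
  then have fin': "finite (B \<union> (\<Union>z\<in>B. {y. E z y}))" using fin by auto
  have "card {y. gdist E x y \<le> Suc n} \<le> card (B \<union> (\<Union>z\<in>B. {y. E z y}))" by (rule card_mono[OF fin' sub])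
  also have "\<dots> \<le> card B + card (\<Union>z\<in>B. {y. E z y})" by (rule card_Un_le)
  also have "card (\<Union>z\<in>B. {y. E z y}) \<le> (\<Sum>z\<in>B. card {y. E z y})" by (rule card_UN_le[OF B(1)])
  also have "\<dots> \<le> (\<Sum>z\<in>B. \<Delta>)" by (intro sum_mono assms)
  also have "card B + (\<Sum>z\<in>B. \<Delta>) = card B * (\<Delta> + 1)" by simp
  also have "\<dots> \<le> (\<Delta> + 1) ^ n * (\<Delta> + 1)" using B(2) by (rule mult_right_mono) simp
  finally show ?case using finite_subset[OF sub fin'] by (simp add: mult.commute)
qed

lemma rough_graph_of_rough_isometry:
  assumes growth: "growth_group S D c\<^sub>1 c\<^sub>2" and graph: "graph E"
    and degree: "\<And>x. card {y. E x y} \<le> \<Delta>"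
    and iso: "rough_isometry (\<lambda>x y. real (gdist E x y)) (\<lambda>x y. real (word_dist S x y)) a b \<phi>"
  shows "\<exists>L M c. rough_graph S D c\<^sub>1 c\<^sub>2 E \<phi> L M c \<Delta>"
proof -
  interpret growth_group S D c\<^sub>1 c\<^sub>2 by (rule growth)
  have ab: "a \<ge> 1" "b \<ge> 0" and lower: "\<And>x y. real (gdist E x y) / a - b \<le> len (- \<phi> x + \<phi> y)"
    and upper: "\<And>x y. real (len (- \<phi> x + \<phi> y)) \<le> a * gdist E x y + b"
    and dense: "\<And>z. \<exists>x. real (len (- z + \<phi> x)) \<le> b"
    using iso unfolding rough_isometry_def word_dist_len by auto
  \<comment> \<open>One number covers both the stretch a + b of an edge and the density b. The
    constant \<open>c\<close> below solves the lower rough isometry bound for image distance 2 L +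
    1; since fibers have image distance 0, it also bounds their diameter.\<close>
  define L where "L = nat \<lceil>a + b\<rceil>"
  have L: "real L \<ge> a + b" "L \<ge> 1" unfolding L_def using ab by linarith+
  define c where "c = nat \<lceil>a * (2 * real L + 1 + b)\<rceil>"
  have c: "real c \<ge> a * (2 * real L + 1 + b)" unfolding c_def by linarith
  have hop: "gdist E x y \<le> c" if "len (- \<phi> x + \<phi> y) \<le> 2 * L + 1" for x y
  proof -
    have "real (gdist E x y) / a \<le> 2 * real L + 1 + b"
      using lower[of x y] that by linarith
    then have "real (gdist E x y) \<le> a * (2 * real L + 1 + b)" using ab by (simp add: divide_le_eq mult.commute)
    then show ?thesis using c by linarith
  qed
  have fiber: "finite {x. \<phi> x = g} \<and> card {x. \<phi> x = g} \<le> (\<Delta> + 1) ^ c" for g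
  proof (cases "{x. \<phi> x = g} = {}")
    case False
    then obtain x where x: "\<phi> x = g" by auto
    have sub: "{x. \<phi> x = g} \<subseteq> {y. gdist E x y \<le> c}" using x by (auto intro!: hop)
    show ?thesis using graph_ball_bounds[OF graph degree, of x c] finite_subset[OF sub] card_mono[OF _ sub] by auto
  qed simp
  have "rough_graph S D c\<^sub>1 c\<^sub>2 E \<phi> L ((\<Delta> + 1) ^ c) c \<Delta>"
  proof unfold_locales
    fix x y assume "E x y"
    then have "gdist E x y \<le> 1" using walk_le[OF walk_Suc[OF walk_0]] by force
    then have "a * gdist E x y \<le> a * 1" using ab by (intro mult_left_mono) auto
    then show "len (- \<phi> x + \<phi> y) \<le> L" using upper[of x y] L by linarith
  next
    fix g
    obtain x where "real (len (- g + \<phi> x)) \<le> b" using dense by blast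
    then have "len (- g + \<phi> x) \<le> L" using L ab by linarith
    then show "\<exists>x. len (- g + \<phi> x) \<le> L" ..
  qed (use graph degree fiber hop L in auto)
  then show ?thesis by blast
qed

text \<open>The distance to \<open>p\<close> is at most linear in the pulled-back length. The
  resulting factor \<open>B powr d\<close> may depend on \<open>d\<close>, because the count of
  independent functions does not see the constants \<open>A\<close>.\<close>

lemma Hd_growth:
  assumes growth: "growth_group S D c\<^sub>1 c\<^sub>2"
    and iso: "rough_isometry (\<lambda>x y. real (gdist E x y)) (\<lambda>x y. real (word_dist S x y)) a b \<phi>"
    and u: "u \<in> Hd E p d" and d: "d \<ge> 0"
  shows "\<exists>A. \<forall>x. \<bar>u x\<bar> \<le> A * (real (word_group.len S (\<phi> x)) + 1) powr d"
proof -
  interpret growth_group S D c\<^sub>1 c\<^sub>2 by (rule growth)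
  have ab: "a \<ge> 1" "b \<ge> 0" and lower: "\<And>x y. real (gdist E x y) / a - b \<le> len (- \<phi> x + \<phi> y)"
    using iso unfolding rough_isometry_def word_dist_len by auto
  obtain C where C: "\<And>x. \<bar>u x\<bar> \<le> C * (real (gdist E x p) + 1) powr d"
    using u unfolding Hd_def by auto
  define B where "B = a * (1 + len (\<phi> p) + b) + 1"
  have B: "B \<ge> 0" unfolding B_def using ab by auto
  have le: "real (gdist E x p) + 1 \<le> B * (real (len (\<phi> x)) + 1)" for x
  proof -
    have "real (gdist E x p) / a \<le> real (len (\<phi> x)) + len (\<phi> p) + b"
      using lower[of x p] len_add[of "- \<phi> x" "\<phi> p"] by simp
    then have "real (gdist E x p) \<le> a * (real (len (\<phi> x)) + (len (\<phi> p) + b))"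
      using ab by (simp add: divide_le_eq mult.commute add.assoc)
    also have "\<dots> \<le> a * ((1 + len (\<phi> p) + b) * (real (len (\<phi> x)) + 1))"
    proof (intro mult_left_mono)
      have "0 \<le> (len (\<phi> p) + b) * real (len (\<phi> x))" using ab by auto
      then show "real (len (\<phi> x)) + (len (\<phi> p) + b) \<le> (1 + len (\<phi> p) + b) * (real (len (\<phi> x)) + 1)"
        by (simp add: algebra_simps)
    qed (use ab in auto)
    finally show ?thesis by (simp add: B_def distrib_right mult.assoc)
  qed
  have "\<bar>u x\<bar> \<le> \<bar>C\<bar> * B powr d * (real (len (\<phi> x)) + 1) powr d" for x
  proof -
    have "\<bar>u x\<bar> \<le> \<bar>C\<bar> * (real (gdist E x p) + 1) powr d"
      by (rule order_trans[OF C]) (intro mult_right_mono, auto)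
    also have "\<dots> \<le> \<bar>C\<bar> * (B * (real (len (\<phi> x)) + 1)) powr d"
      using le[of x] d by (intro mult_left_mono powr_mono2) auto
    also have "\<dots> = \<bar>C\<bar> * B powr d * (real (len (\<phi> x)) + 1) powr d"
      using B by (simp add: powr_mult)
    finally show ?thesis .
  qed
  then show ?thesis by blast
qed

section \<open>From finite independent families to the dimension of the solution space\<close>

lemma vector_space_fscale: "vector_space (fscale :: real \<Rightarrow> ('a \<Rightarrow> real) \<Rightarrow> _)"
  by unfold_locales (auto simp: fscale_def fun_eq_iff algebra_simps)

lemma subspace_Hd: "module.subspace fscale (Hd E p d)"
proof -
  interpret vector_space "fscale :: real \<Rightarrow> ('a \<Rightarrow> real) \<Rightarrow> _" by (rule vector_space_fscale)
  show ?thesis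
  proof (rule subspaceI)
    show "0 \<in> Hd E p d" by (auto simp: Hd_def laplacian_def intro!: exI[of _ 0])
  next
    fix u v assume u: "u \<in> Hd E p d" and v: "v \<in> Hd E p d"
    obtain A B where AB: "\<And>x. \<bar>u x\<bar> \<le> A * (real (gdist E x p) + 1) powr d"
      "\<And>x. \<bar>v x\<bar> \<le> B * (real (gdist E x p) + 1) powr d"
      using u v unfolding Hd_def by auto
    have "\<bar>(u + v) x\<bar> \<le> (A + B) * (real (gdist E x p) + 1) powr d" for x
      using AB[of x] abs_triangle_ineq[of "u x" "v x"] by (simp add: distrib_right)
    moreover have "laplacian E (u + v) x = laplacian E u x + laplacian E v x" for x
      unfolding laplacian_def sum.distrib[symmetric] by (intro sum.cong) auto
    ultimately show "u + v \<in> Hd E p d" using u v by (auto simp: Hd_def)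
  next
    fix c u assume u: "u \<in> Hd E p d"
    obtain A where A: "\<And>x. \<bar>u x\<bar> \<le> A * (real (gdist E x p) + 1) powr d"
      using u unfolding Hd_def by auto
    have "\<bar>fscale c u x\<bar> \<le> (\<bar>c\<bar> * A) * (real (gdist E x p) + 1) powr d" for x
      using mult_left_mono[OF A[of x], of "\<bar>c\<bar>"] by (simp add: fscale_def abs_mult mult.assoc)
    moreover have "laplacian E (fscale c u) x = c * laplacian E u x" for x
      unfolding laplacian_def fscale_def by (simp add: sum_distrib_left right_diff_distrib)
    ultimately show "fscale c u \<in> Hd E p d" using u by (auto simp: Hd_def)
  qed
qed

lemma independent_indep_on:
  assumes ind: "\<not> module.dependent fscale B" and f: "bij_betw f {..<K} B"
  shows "indep_on UNIV f K"
  unfolding indep_on_def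
proof (intro allI impI)
  interpret vector_space "fscale :: real \<Rightarrow> ('a \<Rightarrow> real) \<Rightarrow> _" by (rule vector_space_fscale)
  fix c i assume c: "\<forall>x\<in>UNIV. (\<Sum>i<K. c i * f i x) = 0" and i: "i < K"
  have B: "finite B" using f bij_betw_finite by blast
  define e where "e v = c (inv_into {..<K} f v)" for v
  have e: "e (f i) = c i" if "i < K" for i
    unfolding e_def using f that by (simp add: bij_betw_def)
  have apply_sum: "(\<Sum>j\<in>J. g j) x = (\<Sum>j\<in>J. g j x)" for g :: "nat \<Rightarrow> 'a \<Rightarrow> real" and J x
    by (induction J rule: infinite_finite_induct) auto
  have "(\<Sum>v\<in>B. fscale (e v) v) = (\<Sum>i<K. fscale (e (f i)) (f i))"
    by (rule sum.reindex_bij_betw[OF f, symmetric])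
  also have "\<dots> = (\<Sum>i<K. fscale (c i) (f i))" using e by (intro sum.cong) auto
  also have "\<dots> = 0" using c by (auto simp: fun_eq_iff apply_sum fscale_def)
  finally have "e (f i) = 0"
    using independentD[OF ind B order_refl, of e "f i"] f i by (auto simp: bij_betw_def)
  then show "c i = 0" using e[OF i] by simp
qed

text \<open>A bound on \<open>dim\<close> alone would not exclude infinite dimension, since an
  infinite basis has cardinality 0. The bound is therefore applied first to finite subsets of a
  basis, which forces the basis to be finite.\<close>

lemma dim_le_of_families:
  fixes H :: "('a \<Rightarrow> real) set" and bound :: real
  assumes sub: "module.subspace fscale H"
    and le: "\<And>K f. (\<And>i. i < K \<Longrightarrow> f i \<in> H) \<Longrightarrow> indep_on UNIV f K \<Longrightarrow> real K \<le> bound"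
  shows "fin_dim_fun H \<and> real (vector_space.dim fscale H) \<le> bound"
proof -
  interpret vector_space "fscale :: real \<Rightarrow> ('a \<Rightarrow> real) \<Rightarrow> _" by (rule vector_space_fscale)
  obtain B where B: "B \<subseteq> H" "independent B" "H \<subseteq> span B" "card B = dim H"
    using basis_exists[of H] by blast
  have card_le: "real (card B') \<le> bound" if B': "B' \<subseteq> B" "finite B'" for B'
  proof -
    obtain f where f: "bij_betw f {..<card B'} B'"
      using ex_bij_betw_nat_finite[OF B'(2)] by (auto simp: atLeast0LessThan)
    have "indep_on UNIV f (card B')"
      using independent_mono[OF B(2) B'(1)] f by (rule independent_indep_on)
    moreover have "f i \<in> H" if "i < card B'" for i using f that B' B(1) by (auto simp: bij_betw_def)
    ultimately show ?thesis by (intro le)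
  qed
  have "finite B"
  proof (rule ccontr)
    assume "infinite B"
    then obtain B' where "B' \<subseteq> B" "finite B'" "card B' = nat \<lceil>\<bar>bound\<bar>\<rceil> + 1"
      using infinite_arbitrarily_large by metis
    then show False using card_le[of B'] by linarith
  qed
  moreover have "span B = H" using span_minimal[OF B(1) sub] B(3) by auto
  ultimately show ?thesis using card_le[of B] B unfolding fin_dim_fun_def by auto
qed

theorem theorem1p2:
  fixes E :: "'a \<Rightarrow> 'a \<Rightarrow> bool" and p :: 'a
    and S :: "'g::group_add set" and D :: nat
  assumes "graph E" and "bounded_geometry E"
    and "finite_symmetric_generating S"
    and "polynomial_growth S" and "homogeneous_dimension S D"
    and "roughly_isometric (\<lambda>x y. real (gdist E x y)) (\<lambda>x y. real (word_dist S x y))"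
  shows "\<exists>C::real. \<forall>d::real. d \<ge> 1 \<longrightarrow>
           fin_dim_fun (Hd E p d) \<and>
           real (vector_space.dim fscale (Hd E p d)) \<le> C * d ^ (D - 1)"
proof -
  obtain c\<^sub>1 c\<^sub>2 where growth: "growth_group S D c\<^sub>1 c\<^sub>2" using ex_growth_group assms(3,5) by blast
  obtain \<Delta> where \<Delta>: "\<And>x. card {y. E x y} \<le> \<Delta>" using assms(2) unfolding bounded_geometry_def by blast
  obtain a b \<phi> where iso: "rough_isometry (\<lambda>x y. real (gdist E x y)) (\<lambda>x y. real (word_dist S x y)) a b \<phi>"
    using assms(6) unfolding roughly_isometric_def by blast
  obtain L M c where "rough_graph S D c\<^sub>1 c\<^sub>2 E \<phi> L M c \<Delta>"
    using rough_graph_of_rough_isometry[OF growth assms(1) \<Delta> iso] by blast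
  then interpret rough_graph S D c\<^sub>1 c\<^sub>2 E \<phi> L M c \<Delta> .
  obtain C where C: "\<And>d K f. d \<ge> 1 \<Longrightarrow> polynomial_family f K d \<Longrightarrow> real K \<le> C * d ^ (D - 1)"
    using ex_dimension_bound by blast
  have "fin_dim_fun (Hd E p d) \<and> real (vector_space.dim fscale (Hd E p d)) \<le> C * d ^ (D - 1)"
    if d: "d \<ge> 1" for d :: real
  proof (rule dim_le_of_families[OF subspace_Hd])
    fix K f assume f: "\<And>i. i < K \<Longrightarrow> f i \<in> Hd E p d" and ind: "indep_on UNIV f K"
    have "polynomial_family f K d"
      unfolding polynomial_family_def using ind Hd_growth[OF growth iso f] f d by (auto simp: Hd_def)
    then show "real K \<le> C * d ^ (D - 1)" by (rule C[OF d])
  qed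
  then show ?thesis by blast
qed

end
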